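(* Let $A$ be a finite-dimensional algebra over a field $k$. The map $\Phi: S_\bullet \mapsto \mathcal{T}_\bullet$, which sends a chain of bricks $S_\bullet: I\to \mathrm{brick}(A)$ to the chain of torsion classes $\{\mathcal{T}_j \mid j \text{ an ideal of } I\}$ (where $\mathcal{T}_j$ is the smallest torsion class of $\mathrm{mod}\, A$ containing all $S_i$, $i\in j$), induces a bijection from the set of equivalence classes of maximal chains of bricks to the set of maximal chains of torsion classes of $\mathrm{mod}\, A$.
   Context: Let $A$ be a finite-dimensional algebra over a field $k$ and $\mathrm{mod}\, A$ the category of finite-dimensional right $A$-modules. A torsion class is a full subcategory of $\mathrm{mod}\, A$ closed under extensions and quotients; $\mathrm{tors}(A)$ is the poset of torsion classes ordered by inclusion. It is a complete lattice; in particular, for each set $\mathcal{X}$ of modules there is a smallest torsion class $\mathsf{T}(\mathcal{X})$ containing $\mathcal{X}$. A chain of torsion classes is a totally ordered subposet of $\mathrm{tors}(A)$. Chains of torsion classes are ordered by inclusion, and maximal chains are the maximal elements for this order (they may be infinite). A brick is an $A$-module whose endomorphism ring is a division algebra; $\mathrm{brick}(A)$ is the set of isomorphism classes of bricks of $\mathrm{mod}\, A$. For a totally ordered set $I$, an $I$-chain of bricks is a map $S_\bullet: I\to\mathrm{brick}(A)$, $i\mapsto S_i$, such that $\mathrm{Hom}(S_i,S_j)=0$ for $i<j$. A chain of bricks is an $I$-chain of bricks for some totally ordered set $I$. For chains of bricks $S^1_\bullet$, $S^2_\bullet$ indexed by $I^1$, $I^2$, write $S^1_\bullet\le S^2_\bullet$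 if there is an increasing injection $\iota: I^1\to I^2$ such that $S^1_i\cong S^2_{\iota(i)}$ for all $i\in I^1$. Two chains of bricks are equivalent if $S^1_\bullet\le S^2_\bullet\le S^1_\bullet$. The relation $\le$ induces a partial order on equivalence classes of chains of bricks, and a chain of bricks is maximal if its equivalence class is maximal for this order. An ideal of a totally ordered set $I$ is a subset $j\subseteq I$ such that $l\in j$ whenever $l\le i$ and $i\in j$. For an $I$-chain of bricks $S_\bullet$ and an ideal $j$ of $I$, let $\mathcal{T}_j$ be the smallest torsion class containing the $S_i$, $i\in j$; $\Phi(S_\bullet)$ is the subposet of $\mathrm{tors}(A)$ formed by the $\mathcal{T}_j$, where $j$ runs through the ideals of $I$. *)

theory Defs
  imports "HOL.Hull" "Jordan_Normal_Form.Missing_VectorSpace"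
begin

section \<open>Finite-dimensional algebras and their right modules\<close>

text \<open>The locale \<open>algebra\<close> of HOL-Algebra is restricted to commutative algebras.  Here \<open>A\<close> is an
  arbitrary unital associative algebra; the zero algebra is allowed.\<close>

locale fin_dim_algebra =
  fixes K :: "('k, 'r) ring_scheme" and A :: "('k, 'a, 's) module_scheme"
  assumes vectorspace: "vectorspace K A"
    and ring: "ring A"
    and smult_mult_left: "\<And>c a b. \<lbrakk>c \<in> carrier K; a \<in> carrier A; b \<in> carrier A\<rbrakk>
      \<Longrightarrow> (c \<odot>\<^bsub>A\<^esub> a) \<otimes>\<^bsub>A\<^esub> b = c \<odot>\<^bsub>A\<^esub> (a \<otimes>\<^bsub>A\<^esub> b)"
    and smult_mult_right: "\<And>c a b. \<lbrakk>c \<in> carrier K; a \<in> carrier A; b \<in> carrier A\<rbrakk>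
      \<Longrightarrow> a \<otimes>\<^bsub>A\<^esub> (c \<odot>\<^bsub>A\<^esub> b) = c \<odot>\<^bsub>A\<^esub> (a \<otimes>\<^bsub>A\<^esub> b)"
    and fin_dim: "vectorspace.fin_dim K A"

text \<open>Right modules are stored in the record \<open>module\<close>: the element usually written \<open>x a\<close>
  (with \<open>x\<close> in \<open>M\<close> and \<open>a\<close> in \<open>A\<close>) is \<open>a \<odot>\<^bsub>M\<^esub> x\<close>; note the order of the factors in
  \<open>act_assoc\<close>.  The fields \<open>mult\<close> and \<open>one\<close> that \<open>module\<close> inherits from \<open>ring\<close> carry no information.
  The set \<open>module_hom A M N\<close> consists of the maps that are additive and commute with this action.\<close>

locale right_module =
  fixes A :: "('a, 'r) ring_scheme" and M :: "('a, 'v, 's) module_scheme"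
  assumes base_ring: "ring A"
    and abelian_group: "abelian_group M"
    and act_closed: "\<And>a x. \<lbrakk>a \<in> carrier A; x \<in> carrier M\<rbrakk> \<Longrightarrow> a \<odot>\<^bsub>M\<^esub> x \<in> carrier M"
    and act_add_scalar: "\<And>a b x. \<lbrakk>a \<in> carrier A; b \<in> carrier A; x \<in> carrier M\<rbrakk>
      \<Longrightarrow> (a \<oplus>\<^bsub>A\<^esub> b) \<odot>\<^bsub>M\<^esub> x = a \<odot>\<^bsub>M\<^esub> x \<oplus>\<^bsub>M\<^esub> b \<odot>\<^bsub>M\<^esub> x"
    and act_add: "\<And>a x y. \<lbrakk>a \<in> carrier A; x \<in> carrier M; y \<in> carrier M\<rbrakk>
      \<Longrightarrow> a \<odot>\<^bsub>M\<^esub> (x \<oplus>\<^bsub>M\<^esub> y) = a \<odot>\<^bsub>M\<^esub> x \<oplus>\<^bsub>M\<^esub> a \<odot>\<^bsub>M\<^esub> y"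
    and act_assoc: "\<And>a b x. \<lbrakk>a \<in> carrier A; b \<in> carrier A; x \<in> carrier M\<rbrakk>
      \<Longrightarrow> (a \<otimes>\<^bsub>A\<^esub> b) \<odot>\<^bsub>M\<^esub> x = b \<odot>\<^bsub>M\<^esub> (a \<odot>\<^bsub>M\<^esub> x)"
    and act_one: "\<And>x. x \<in> carrier M \<Longrightarrow> \<one>\<^bsub>A\<^esub> \<odot>\<^bsub>M\<^esub> x = x"

definition scalar_restriction ::
    "('k, 'r) ring_scheme \<Rightarrow> ('k, 'a, 's) module_scheme \<Rightarrow> ('a, 'v) module \<Rightarrow> ('k, 'v) module" where
  "scalar_restriction K A M =
    \<lparr>carrier = carrier M, mult = mult M, one = one M, zero = zero M, add = add M,
     smult = (\<lambda>c x. (c \<odot>\<^bsub>A\<^esub> \<one>\<^bsub>A\<^esub>) \<odot>\<^bsub>M\<^esub> x)\<rparr>"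

definition fd_right_module ::
    "('k, 'r) ring_scheme \<Rightarrow> ('k, 'a, 's) module_scheme \<Rightarrow> ('a, 'v) module \<Rightarrow> bool" where
  "fd_right_module K A M \<longleftrightarrow>
    right_module A M \<and> vectorspace.fin_dim K (scalar_restriction K A M)"

text \<open>The objects of mod \<open>A\<close> must live in one type.  The type of lists of scalars contains a copy of
  each coordinate space \<open>K\<^sup>n\<close>, hence an isomorphic copy of every finite-dimensional module;
  this is the lemma \<open>fd_module_in_mod_cat\<close> below.\<close>

definition mod_cat ::
    "('k, 'r) ring_scheme \<Rightarrow> ('k, 'a, 's) module_scheme \<Rightarrow> ('a, 'k list) module set" where
  "mod_cat K A = {M. fd_right_module K A M}"

definition module_iso ::
    "('a, 'r) ring_scheme \<Rightarrow> ('a, 'v) module \<Rightarrow> ('a, 'w) module \<Rightarrow> bool" where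
  "module_iso A M N \<longleftrightarrow> (\<exists>f \<in> module_hom A M N. bij_betw f (carrier M) (carrier N))"

definition hom_zero ::
    "('a, 'r) ring_scheme \<Rightarrow> ('a, 'v) module \<Rightarrow> ('a, 'w) module \<Rightarrow> bool" where
  "hom_zero A M N \<longleftrightarrow> (\<forall>f \<in> module_hom A M N. \<forall>x \<in> carrier M. f x = \<zero>\<^bsub>N\<^esub>)"

definition short_exact ::
    "('a, 'r) ring_scheme \<Rightarrow> ('a, 'u) module \<Rightarrow> ('a, 'v) module \<Rightarrow> ('a, 'w) module \<Rightarrow> bool" where
  "short_exact A L M N \<longleftrightarrow>
    (\<exists>f \<in> module_hom A L M. \<exists>g \<in> module_hom A M N.
      inj_on f (carrier L) \<and>
      f ` carrier L = {x \<in> carrier M. g x = \<zero>\<^bsub>N\<^esub>} \<and>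
      g ` carrier M = carrier N)"


section \<open>Torsion classes\<close>

text \<open>A full subcategory is given by its set of objects.  It has to contain the zero objects (so it
  is not empty); closure under isomorphism is the case of a bijective \<open>f\<close> in the third conjunct.\<close>

definition torsion_class ::
    "('k, 'r) ring_scheme \<Rightarrow> ('k, 'a, 's) module_scheme \<Rightarrow> ('a, 'k list) module set \<Rightarrow> bool" where
  "torsion_class K A T \<longleftrightarrow>
    T \<subseteq> mod_cat K A \<and>
    (\<forall>M \<in> mod_cat K A. carrier M = {\<zero>\<^bsub>M\<^esub>} \<longrightarrow> M \<in> T) \<and>
    (\<forall>M \<in> T. \<forall>N \<in> mod_cat K A.
      (\<exists>f \<in> module_hom A M N. f ` carrier M = carrier N) \<longrightarrow> N \<in> T) \<and>
    (\<forall>L \<in> T. \<forall>N \<in> T. \<forall>M \<in> mod_cat K A. short_exact A L M N \<longrightarrow> M \<in> T)"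

definition tors ::
    "('k, 'r) ring_scheme \<Rightarrow> ('k, 'a, 's) module_scheme \<Rightarrow> ('a, 'k list) module set set" where
  "tors K A = {T. torsion_class K A T}"

definition torsion_closure ::
    "('k, 'r) ring_scheme \<Rightarrow> ('k, 'a, 's) module_scheme \<Rightarrow> ('a, 'k list) module set
      \<Rightarrow> ('a, 'k list) module set" where
  "torsion_closure K A X = torsion_class K A hull X"


section \<open>Bricks\<close>

text \<open>Endomorphisms are taken extensional, so that equal maps on \<open>M\<close> are equal elements.\<close>

definition End_ring :: "('a, 'r) ring_scheme \<Rightarrow> ('a, 'v) module \<Rightarrow> ('v \<Rightarrow> 'v) ring" where
  "End_ring A M =
    \<lparr>carrier = module_hom A M M \<inter> extensional (carrier M),
     mult = compose (carrier M),
     one = (\<lambda>x \<in> carrier M. x),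
     zero = (\<lambda>x \<in> carrier M. \<zero>\<^bsub>M\<^esub>),
     add = (\<lambda>f g. \<lambda>x \<in> carrier M. f x \<oplus>\<^bsub>M\<^esub> g x)\<rparr>"

locale skew_field = ring R for R (structure) +
  assumes one_not_zero: "\<one> \<noteq> \<zero>"
    and skew_field_Units: "Units R = carrier R - {\<zero>}"

definition brick ::
    "('k, 'r) ring_scheme \<Rightarrow> ('k, 'a, 's) module_scheme \<Rightarrow> ('a, 'k list) module \<Rightarrow> bool" where
  "brick K A M \<longleftrightarrow> M \<in> mod_cat K A \<and> skew_field (End_ring A M)"

definition iso_class ::
    "('k, 'r) ring_scheme \<Rightarrow> ('k, 'a, 's) module_scheme \<Rightarrow> ('a, 'k list) module
      \<Rightarrow> ('a, 'k list) module set" where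
  "iso_class K A M = {N \<in> mod_cat K A. module_iso A M N}"

definition brick_classes ::
    "('k, 'r) ring_scheme \<Rightarrow> ('k, 'a, 's) module_scheme \<Rightarrow> ('a, 'k list) module set set" where
  "brick_classes K A = iso_class K A ` {M. brick K A M}"


section \<open>Chains of bricks\<close>

text \<open>A totally ordered set \<open>I\<close> is a relation \<open>r\<close> with \<open>Linear_order r\<close> and \<open>I = Field r\<close>.  In a pair
  \<open>(r, S)\<close> the values of \<open>S\<close> outside \<open>Field r\<close> are irrelevant.\<close>

type_synonym ('i, 'c) chain = "'i rel \<times> ('i \<Rightarrow> 'c)"

definition brick_chain ::
    "('k, 'r) ring_scheme \<Rightarrow> ('k, 'a, 's) module_scheme
      \<Rightarrow> ('i, ('a, 'k list) module set) chain \<Rightarrow> bool" where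
  "brick_chain K A = (\<lambda>(r, S).
    Linear_order r \<and>
    (\<forall>i \<in> Field r. S i \<in> brick_classes K A) \<and>
    (\<forall>i j. (i, j) \<in> r \<and> i \<noteq> j \<longrightarrow> (\<forall>M \<in> S i. \<forall>N \<in> S j. hom_zero A M N)))"

definition chain_le :: "('i, 'c) chain \<Rightarrow> ('j, 'c) chain \<Rightarrow> bool" where
  "chain_le = (\<lambda>(r, S) (r', S').
    \<exists>\<iota> \<in> Field r \<rightarrow> Field r'.
      inj_on \<iota> (Field r) \<and>
      (\<forall>i j. (i, j) \<in> r \<longrightarrow> (\<iota> i, \<iota> j) \<in> r') \<and>
      (\<forall>i \<in> Field r. S i = S' (\<iota> i)))"

text \<open>As Hom does not vanish between isomorphic bricks, a chain of bricks is an injective map.  It can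
  therefore be indexed by a set of isomorphism classes, and fixing this type of indices loses no chain
  of bricks up to equivalence; see \<open>brick_chain_reindex\<close> below.\<close>

definition brick_chains ::
    "('k, 'r) ring_scheme \<Rightarrow> ('k, 'a, 's) module_scheme
      \<Rightarrow> (('a, 'k list) module set, ('a, 'k list) module set) chain set" where
  "brick_chains K A = {c. brick_chain K A c}"

definition brick_chain_equiv ::
    "('k, 'r) ring_scheme \<Rightarrow> ('k, 'a, 's) module_scheme
      \<Rightarrow> (('a, 'k list) module set, ('a, 'k list) module set) chain rel" where
  "brick_chain_equiv K A =
    {(c, d). c \<in> brick_chains K A \<and> d \<in> brick_chains K A \<and> chain_le c d \<and> chain_le d c}"

definition max_brick_chains ::
    "('k, 'r) ring_scheme \<Rightarrow> ('k, 'a, 's) module_scheme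
      \<Rightarrow> (('a, 'k list) module set, ('a, 'k list) module set) chain set" where
  "max_brick_chains K A =
    {c \<in> brick_chains K A.
      \<forall>d \<in> brick_chains K A. chain_le c d \<longrightarrow> (c, d) \<in> brick_chain_equiv K A}"

definition order_ideal :: "'i rel \<Rightarrow> 'i set \<Rightarrow> bool" where
  "order_ideal r J \<longleftrightarrow> J \<subseteq> Field r \<and> (\<forall>i \<in> J. \<forall>l. (l, i) \<in> r \<longrightarrow> l \<in> J)"

definition Phi ::
    "('k, 'r) ring_scheme \<Rightarrow> ('k, 'a, 's) module_scheme
      \<Rightarrow> ('i, ('a, 'k list) module set) chain \<Rightarrow> ('a, 'k list) module set set" where
  "Phi K A = (\<lambda>(r, S). {torsion_closure K A (\<Union>i \<in> J. S i) |J. order_ideal r J})"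


section \<open>Adequacy of the encodings\<close>

lemma (in fin_dim_algebra) vectorspace_scalar_restriction:
  fixes M :: "('a, 'v) module"
  assumes "right_module A M"
  shows "vectorspace K (scalar_restriction K A M)"
proof -
  interpret V: vectorspace K A by (rule vectorspace)
  interpret A: ring A by (rule ring)
  interpret M: right_module A M by (rule assms)
  interpret G: abelian_group M by (rule M.abelian_group)
  let ?N = "scalar_restriction K A M"
  have [simp]: "c \<odot>\<^bsub>A\<^esub> \<one>\<^bsub>A\<^esub> \<in> carrier A" if "c \<in> carrier K" for c
    using that by simp
  have ab: "abelian_group ?N"
  proof (rule abelian_groupI)
    fix x assume "x \<in> carrier ?N"
    thus "\<exists>y\<in>carrier ?N. y \<oplus>\<^bsub>?N\<^esub> x = \<zero>\<^bsub>?N\<^esub>"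
      using G.l_neg by (auto simp: scalar_restriction_def intro!: bexI[of _ "\<ominus>\<^bsub>M\<^esub> x"])
  qed (auto simp: scalar_restriction_def G.a_ac)
  have "module K ?N"
  proof (rule moduleI)
    fix a b x assume *: "a \<in> carrier K" "b \<in> carrier K" "x \<in> carrier ?N"
    hence x: "x \<in> carrier M" by (simp add: scalar_restriction_def)
    have "(a \<otimes>\<^bsub>K\<^esub> b) \<odot>\<^bsub>A\<^esub> \<one>\<^bsub>A\<^esub> = (b \<odot>\<^bsub>A\<^esub> \<one>\<^bsub>A\<^esub>) \<otimes>\<^bsub>A\<^esub> (a \<odot>\<^bsub>A\<^esub> \<one>\<^bsub>A\<^esub>)"
      using * V.smult_assoc1[of a b "\<one>\<^bsub>A\<^esub>"] V.smult_assoc1[of b a "\<one>\<^bsub>A\<^esub>"] V.m_comm[of a b]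
      by (simp add: smult_mult_left smult_mult_right)
    thus "(a \<otimes>\<^bsub>K\<^esub> b) \<odot>\<^bsub>?N\<^esub> x = a \<odot>\<^bsub>?N\<^esub> (b \<odot>\<^bsub>?N\<^esub> x)"
      using * x by (simp add: scalar_restriction_def M.act_assoc)
    show "(a \<oplus>\<^bsub>K\<^esub> b) \<odot>\<^bsub>?N\<^esub> x = a \<odot>\<^bsub>?N\<^esub> x \<oplus>\<^bsub>?N\<^esub> b \<odot>\<^bsub>?N\<^esub> x"
      using * x by (simp add: scalar_restriction_def M.act_add_scalar V.smult_l_distr)
  qed (use ab V.R.is_cring in \<open>auto simp: scalar_restriction_def M.act_closed M.act_add M.act_one\<close>)
  thus ?thesis by (intro vectorspace.intro V.field_axioms)
qed

lemma (in fin_dim_algebra) fd_module_in_mod_cat: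
  fixes M :: "('a, 'v) module"
  assumes "fd_right_module K A M"
  shows "\<exists>N \<in> mod_cat K A. module_iso A M N"
proof -
  interpret A: ring A by (rule ring)
  from assms have rm: "right_module A M"
    and fd: "vectorspace.fin_dim K (scalar_restriction K A M)"
    by (simp_all add: fd_right_module_def)
  interpret M: right_module A M by (rule rm)
  interpret G: abelian_group M by (rule M.abelian_group)
  let ?V = "scalar_restriction K A M"
  interpret V: vectorspace K ?V by (rule vectorspace_scalar_restriction[OF rm])
  have cV: "carrier ?V = carrier M" by (simp add: scalar_restriction_def)
  obtain B where B: "finite B" "B \<subseteq> carrier ?V" "V.span B = carrier ?V"
    using fd unfolding V.fin_dim_def by blast
  obtain bs where bs: "set bs = B" using B(1) finite_list by blast
  have "carrier M = {V.lincomb c B |c. c \<in> B \<rightarrow> carrier K}"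
    using B(3) V.finite_span[OF B(1,2)] cV by simp
  hence "\<forall>x \<in> carrier M. \<exists>c. c \<in> B \<rightarrow> carrier K \<and> x = V.lincomb c B" by blast
  then obtain c where c: "\<And>x. x \<in> carrier M \<Longrightarrow> c x \<in> B \<rightarrow> carrier K"
      "\<And>x. x \<in> carrier M \<Longrightarrow> x = V.lincomb (c x) B"
    by metis
  define h where "h x = map (c x) bs" for x
  have inj: "inj_on h (carrier M)"
  proof (rule inj_onI)
    fix x y assume xy: "x \<in> carrier M" "y \<in> carrier M" "h x = h y"
    have "V.lincomb (c x) B = V.lincomb (c y) B"
      using xy(3) c(1)[OF xy(2)] B(2) bs by (intro V.lincomb_cong) (auto simp: h_def)
    thus "x = y" using c(2) xy by metis
  qed
  define g where "g = inv_into (carrier M) h"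
  have gh [simp]: "g (h x) = x" if "x \<in> carrier M" for x
    using that inj by (simp add: g_def)
  define N where "N = \<lparr>carrier = h ` carrier M, mult = (\<lambda>u v. u), one = h \<zero>\<^bsub>M\<^esub>, zero = h \<zero>\<^bsub>M\<^esub>,
    add = (\<lambda>u v. h (g u \<oplus>\<^bsub>M\<^esub> g v)), smult = (\<lambda>a u. h (a \<odot>\<^bsub>M\<^esub> g u))\<rparr>"
  have abN: "abelian_group N"
  proof (rule abelian_groupI)
    fix u assume "u \<in> carrier N"
    then obtain x where "x \<in> carrier M" "u = h x" by (auto simp: N_def)
    thus "\<exists>v\<in>carrier N. v \<oplus>\<^bsub>N\<^esub> u = \<zero>\<^bsub>N\<^esub>"
      by (intro bexI[of _ "h (\<ominus>\<^bsub>M\<^esub> x)"]) (auto simp: N_def G.l_neg)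
  qed (auto simp: N_def G.a_ac)
  have rmN: "right_module A N"
    by (rule right_module.intro[OF ring abN])
      (auto simp: N_def M.act_closed M.act_add_scalar M.act_add M.act_assoc M.act_one)
  have hom: "h \<in> module_hom A M N"
    by (auto simp: module_hom_def N_def M.act_closed)
  let ?W = "scalar_restriction K A N"
  interpret W: vectorspace K ?W by (rule vectorspace_scalar_restriction[OF rmN])
  have one: "c \<odot>\<^bsub>A\<^esub> \<one>\<^bsub>A\<^esub> \<in> carrier A" if "c \<in> carrier K" for c
    by (rule module.smult_closed[OF vectorspace.axioms(1)[OF vectorspace] that A.one_closed])
  have "h \<in> module_hom K ?V ?W"
    using hom one by (simp add: module_hom_def scalar_restriction_def)
  then interpret T: linear_map K ?V ?W h
    by (intro linear_map.intro mod_hom.intro mod_hom_axioms.intro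
        V.vectorspace_axioms W.vectorspace_axioms V.module_axioms W.module_axioms)
  have "W.fin_dim"
    by (rule T.rank_nullity_main(2)[OF fd]) (simp add: scalar_restriction_def N_def)
  hence "N \<in> mod_cat K A" using rmN by (simp add: mod_cat_def fd_right_module_def)
  moreover have "bij_betw h (carrier M) (carrier N)"
    using inj by (simp add: bij_betw_def N_def)
  ultimately show ?thesis using hom by (auto simp: module_iso_def)
qed

lemma torsion_class_Inter:
  assumes T: "\<And>T. T \<in> F \<Longrightarrow> torsion_class K A T" and F: "F \<noteq> {}"
  shows "torsion_class K A (\<Inter>F)"
proof -
  have 1: "\<Inter>F \<subseteq> mod_cat K A"
    using F T[unfolded torsion_class_def] by (metis Inf_lower2 all_not_in_conv)
  have 2: "M \<in> \<Inter>F" if "M \<in> mod_cat K A" "carrier M = {\<zero>\<^bsub>M\<^esub>}" for M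
    using that T by (simp add: torsion_class_def)
  have 3: "N \<in> \<Inter>F"
    if "M \<in> \<Inter>F" "N \<in> mod_cat K A" "\<exists>f\<in>module_hom A M N. f ` carrier M = carrier N" for M N
  proof
    fix X assume "X \<in> F"
    hence M: "M \<in> X" and X: "torsion_class K A X" using that(1) T by blast+
    show "N \<in> X"
      by (rule X[unfolded torsion_class_def, THEN conjunct2, THEN conjunct2, THEN conjunct1,
            THEN bspec, OF M, THEN bspec, OF that(2), THEN mp, OF that(3)])
  qed
  have 4: "M \<in> \<Inter>F"
    if "L \<in> \<Inter>F" "N \<in> \<Inter>F" "M \<in> mod_cat K A" "short_exact A L M N" for L M N
  proof
    fix X assume "X \<in> F"
    hence L: "L \<in> X" and N: "N \<in> X" and X: "torsion_class K A X" using that(1,2) T by blast+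
    show "M \<in> X"
      by (rule X[unfolded torsion_class_def, THEN conjunct2, THEN conjunct2, THEN conjunct2,
            THEN bspec, OF L, THEN bspec, OF N, THEN bspec, OF that(3), THEN mp, OF that(4)])
  qed
  show ?thesis unfolding torsion_class_def
    by (intro conjI ballI impI) (rule 1, erule (1) 2, erule (2) 3, erule (3) 4)
qed

lemma torsion_class_mod_cat: "torsion_class K A (mod_cat K A)"
  by (auto simp: torsion_class_def)

lemma torsion_closure_least:
  assumes "X \<subseteq> mod_cat K A"
  shows "torsion_closure K A X \<in> tors K A"
    and "X \<subseteq> torsion_closure K A X"
    and "\<And>T. \<lbrakk>T \<in> tors K A; X \<subseteq> T\<rbrakk> \<Longrightarrow> torsion_closure K A X \<subseteq> T"
proof -
  show "torsion_closure K A X \<in> tors K A"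
    unfolding tors_def torsion_closure_def hull_def
    using assms torsion_class_mod_cat by (auto intro!: torsion_class_Inter)
  show "X \<subseteq> torsion_closure K A X"
    by (simp add: torsion_closure_def hull_subset)
  show "torsion_closure K A X \<subseteq> T" if "T \<in> tors K A" "X \<subseteq> T" for T
    using that by (simp add: torsion_closure_def tors_def hull_minimal)
qed

lemma brick_not_hom_zero:
  assumes "brick K A M"
  shows "\<not> hom_zero A M M"
proof
  assume *: "hom_zero A M M"
  have "(\<lambda>x. x) \<in> module_hom A M M" by (auto simp: module_hom_def)
  hence zero: "x = \<zero>\<^bsub>M\<^esub>" if "x \<in> carrier M" for x
    using that by (rule bspec[OF bspec[OF *[unfolded hom_zero_def]]])
  have "(\<lambda>x \<in> carrier M. x) = (\<lambda>x \<in> carrier M. \<zero>\<^bsub>M\<^esub>)"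
    by (rule restrict_ext) (rule zero)
  hence "\<one>\<^bsub>End_ring A M\<^esub> = \<zero>\<^bsub>End_ring A M\<^esub>"
    by (simp add: End_ring_def)
  moreover have "skew_field (End_ring A M)" using assms by (simp add: brick_def)
  ultimately show False using skew_field.one_not_zero by blast
qed

lemma brick_chain_inj_on:
  assumes "brick_chain K A (r, S)"
  shows "inj_on S (Field r)"
proof (rule inj_onI, rule ccontr)
  fix i j assume ij: "i \<in> Field r" "j \<in> Field r" "S i = S j" "i \<noteq> j"
  obtain M where M: "brick K A M" "S i = iso_class K A M"
    using assms ij(1) by (auto simp: brick_chain_def brick_classes_def)
  have "(\<lambda>x. x) \<in> module_hom A M M" by (auto simp: module_hom_def)
  hence "module_iso A M M" by (auto simp: module_iso_def bij_betw_def inj_on_def intro!: bexI)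
  hence "M \<in> S i" using M by (simp add: iso_class_def brick_def)
  moreover have "(i, j) \<in> r \<or> (j, i) \<in> r"
    using assms ij by (auto simp: brick_chain_def linear_order_on_def total_on_def)
  ultimately show False
    using assms ij brick_not_hom_zero[OF M(1)] unfolding brick_chain_def by fastforce
qed

lemma brick_chain_reindex:
  assumes "brick_chain K A (r, S)"
  shows "\<exists>c \<in> brick_chains K A. chain_le (r, S) c \<and> chain_le c (r, S)"
proof -
  let ?c = "(dir_image r S, \<lambda>X. X)"
  have r: "Linear_order r" using assms by (simp add: brick_chain_def)
  have inj: "inj_on S (Field r)" by (rule brick_chain_inj_on[OF assms])
  have F: "Field (dir_image r S) = S ` Field r" by (rule dir_image_Field)
  have "brick_chain K A ?c"
    using assms Linear_order_dir_image[OF r inj] F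
    by (force simp: brick_chain_def dir_image_def)
  moreover have "chain_le (r, S) ?c"
    using inj F by (auto simp: chain_le_def dir_image_def intro!: bexI[of _ S])
  moreover have "chain_le ?c (r, S)"
    using inj F
    by (auto simp: chain_le_def dir_image_def inj_on_def FieldI1 FieldI2
        intro!: bexI[of _ "inv_into (Field r) S"])
  ultimately show ?thesis by (auto simp: brick_chains_def)
qed

lemma chain_le_refl: "chain_le c c"
  by (cases c) (auto simp: chain_le_def intro!: bexI[of _ "\<lambda>x. x"])

lemma chain_le_trans:
  assumes "chain_le c d" "chain_le d e"
  shows "chain_le c e"
proof -
  obtain r S r' S' r'' S'' where eq: "c = (r, S)" "d = (r', S')" "e = (r'', S'')"
    by (metis surj_pair)
  obtain f where f: "f \<in> Field r \<rightarrow> Field r'" "inj_on f (Field r)"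
    "\<forall>i j. (i, j) \<in> r \<longrightarrow> (f i, f j) \<in> r'" "\<forall>i \<in> Field r. S i = S' (f i)"
    using assms(1) by (auto simp: chain_le_def eq)
  obtain g where g: "g \<in> Field r' \<rightarrow> Field r''" "inj_on g (Field r')"
    "\<forall>i j. (i, j) \<in> r' \<longrightarrow> (g i, g j) \<in> r''" "\<forall>i \<in> Field r'. S' i = S'' (g i)"
    using assms(2) by (auto simp: chain_le_def eq)
  have "inj_on (g \<circ> f) (Field r)"
    using f g by (intro comp_inj_on) (auto intro: inj_on_subset)
  thus ?thesis unfolding eq chain_le_def prod.case
    using f g by (intro bexI[of _ "g \<circ> f"]) auto
qed

lemma equiv_brick_chain_equiv: "equiv (brick_chains K A) (brick_chain_equiv K A)"
  by (rule equivI)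
    (auto simp: brick_chain_equiv_def refl_on_def sym_def trans_def
      intro: chain_le_refl chain_le_trans)

end

theory Submission
  imports Defs
begin

text \<open>
  A maximal chain \<open>C\<close> of torsion classes is closed under unions and intersections.  If \<open>U \<subset> V\<close> is a
  jump of \<open>C\<close>, a torsion class that contains \<open>U\<close> and meets \<open>V - U\<close> contains \<open>V\<close>.  Hence any two bricks
  of \<open>V\<close> on which \<open>Hom(U, -)\<close> vanishes are isomorphic, and such a brick exists: a module of minimal
  dimension in \<open>V - U\<close>.  The labels of the jumps, ordered by the upper ends, form a chain of bricks
  \<open>\<Psi>(C)\<close>.

  A module \<open>M \<noteq> 0\<close> singles out two jumps of \<open>C\<close>: the one where \<open>Hom(-, M)\<close> stops vanishing, whose
  label maps nontrivially to \<open>M\<close>, and the one where \<open>M\<close> enters \<open>C\<close>, to whose label \<open>M\<close> maps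
  nontrivially.  The first gives \<open>\<Phi>(\<Psi>(C)) = C\<close>; both together show that no brick can be inserted into
  \<open>\<Psi>(C)\<close>.  If \<open>S\<close> is any chain of bricks with \<open>\<Phi>(S) \<subseteq> C\<close>, then \<open>S\<^sub>i\<close> is the label of the first jump
  for \<open>M = S\<^sub>i\<close>, because every nonzero map from the torsion class generated by the \<open>S\<^sub>l\<close>, \<open>l \<le> i\<close>, to
  \<open>S\<^sub>i\<close> is surjective; so \<open>S \<le> \<Psi>(C)\<close>.  Thus \<open>\<Psi>\<close> is inverse to \<open>\<Phi>\<close> on maximal chains.
\<close>

section \<open>Finite-dimensional modules\<close>

text \<open>A set that is independent in \<open>vs W\<close> is independent in \<open>V\<close>, so
  its size is bounded by \<open>dim\<close> and a maximal one exists; it is a basis of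
  \<open>vs W\<close>. If it has \<open>dim\<close> elements, it is a basis of \<open>V\<close> as
  well.\<close>

lemma (in vectorspace) subspace_fin_dim_dim:
  assumes fd: fin_dim and W: "subspace K W V"
  shows "vectorspace.fin_dim K (vs W)"
    and "vectorspace.dim K (vs W) \<le> dim"
    and "vectorspace.dim K (vs W) = dim \<Longrightarrow> W = carrier V"
proof -
  interpret W: vectorspace K "vs W" by (rule subspace_is_vs[OF W])
  have sm: "submodule K W V" using W by (rule subspace.submod)
  have WV: "W \<subseteq> carrier V" by (rule submodule.subset[OF sm])
  have li: "lin_indpt X" if "X \<subseteq> W" "W.lin_indpt X" for X
    using that span_li_not_depend(2)[OF that(1) sm] by simp
  have "\<exists>B. finite B \<and> maximal B (\<lambda>S. S \<subseteq> carrier (vs W) \<and> W.lin_indpt S)"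
  proof (rule maximal_exists[where N=dim and B="{}"])
    show "finite X \<and> card X \<le> dim" if "X \<subseteq> carrier (vs W) \<and> W.lin_indpt X" for X
      using that li li_le_dim[OF fd, of X] WV by auto
    show "{} \<subseteq> carrier (vs W) \<and> W.lin_indpt {}" by (auto simp: W.lin_dep_def)
  qed
  then obtain B where B: "finite B" "W.basis B"
    using W.max_li_is_basis by blast
  have BW: "B \<subseteq> W" "W.lin_indpt B" "W.span B = W" using B(2) by (auto simp: W.basis_def)
  have d: "W.dim = card B" by (rule W.dim_basis[OF B])
  show "W.fin_dim" unfolding W.fin_dim_def using B BW by auto
  show "W.dim \<le> dim" using d li_le_dim[OF fd _ li[OF BW(1,2)]] BW(1) WV by auto
  show "W = carrier V" if "W.dim = dim"
  proof -
    have "basis B" using dim_li_is_basis[OF fd B(1) _ li[OF BW(1,2)]] BW(1) WV d that by auto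
    thus ?thesis using span_li_not_depend(1)[OF BW(1) sm] BW(3) by (simp add: basis_def)
  qed
qed

text \<open>Rank-nullity. The drop of the dimension under a non-injective surjection drives the
  minimality argument in \<open>brick_between\<close>; the equality case turns surjections in both
  directions into an isomorphism in \<open>label_iso\<close>.\<close>

lemma (in linear_map) surj_dim:
  assumes fd: V.fin_dim and surj: "T ` carrier V = carrier W"
  shows "W.dim \<le> V.dim" and "W.dim = V.dim \<Longrightarrow> inj_on T (carrier V)"
proof -
  have W: "W.vs imT = W" using surj by (simp add: im_def)
  have eq: "W.dim + vectorspace.dim K (V.vs kerT) = V.dim"
    using rank_nullity[OF fd] W by simp
  thus "W.dim \<le> V.dim" by simp
  interpret ker: vectorspace K "V.vs kerT" by (rule V.subspace_is_vs[OF kerT_is_subspace])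
  assume "W.dim = V.dim"
  hence "ker.dim = 0" using eq by simp
  moreover obtain B where "finite B" "ker.basis B"
    using ker.finite_basis_exists V.subspace_fin_dim_dim(1)[OF fd kerT_is_subspace] by blast
  ultimately have "ker.basis {}" using ker.dim_basis by fastforce
  hence "kerT = {\<zero>\<^bsub>V\<^esub>}" using ker.span_empty by (simp add: ker.basis_def)
  thus "inj_on T (carrier V)" by (intro Ke0_imp_inj) simp
qed

lemma (in right_module) act_zero:
  assumes "a \<in> carrier A"
  shows "a \<odot>\<^bsub>M\<^esub> \<zero>\<^bsub>M\<^esub> = \<zero>\<^bsub>M\<^esub>"
proof -
  interpret G: abelian_group M by (rule abelian_group)
  show ?thesis
    using act_add[OF assms, of "\<zero>\<^bsub>M\<^esub>" "\<zero>\<^bsub>M\<^esub>"] assms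
    by (metis G.add.l_cancel_one' G.l_zero G.zero_closed act_closed)
qed

context fin_dim_algebra
begin

interpretation A: ring A by (rule ring)

lemma scalar_in_carrier: "c \<in> carrier K \<Longrightarrow> c \<odot>\<^bsub>A\<^esub> \<one>\<^bsub>A\<^esub> \<in> carrier A"
  by (rule module.smult_closed[OF vectorspace.axioms(1)[OF vectorspace] _ A.one_closed])

definition dimension :: "('a, 'k list) module \<Rightarrow> nat" where
  "dimension M = vectorspace.dim K (scalar_restriction K A M)"

text \<open>A submodule is a bare set; the module on it is the record
  \<open>M\<lparr>carrier := Y\<rparr>\<close>, which keeps the operations of \<open>M\<close>.
  Closure under negatives follows, because \<open>Y\<close> is then a subspace over
  \<open>K\<close>.\<close>

definition is_submodule :: "'k list set \<Rightarrow> ('a, 'k list) module \<Rightarrow> bool" where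
  "is_submodule Y M \<longleftrightarrow> Y \<subseteq> carrier M \<and> \<zero>\<^bsub>M\<^esub> \<in> Y \<and> (\<forall>x\<in>Y. \<forall>y\<in>Y. x \<oplus>\<^bsub>M\<^esub> y \<in> Y) \<and>
    (\<forall>a\<in>carrier A. \<forall>x\<in>Y. a \<odot>\<^bsub>M\<^esub> x \<in> Y)"

section \<open>Homomorphisms, submodules and quotients\<close>

lemma mod_cat_right_module: "M \<in> mod_cat K A \<Longrightarrow> right_module A M"
  by (simp add: mod_cat_def fd_right_module_def)

lemma mod_cat_abelian_group: "M \<in> mod_cat K A \<Longrightarrow> abelian_group M"
  by (rule right_module.abelian_group[OF mod_cat_right_module])

lemma mod_cat_vectorspace: "M \<in> mod_cat K A \<Longrightarrow> vectorspace K (scalar_restriction K A M)"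
  by (rule vectorspace_scalar_restriction[OF mod_cat_right_module])

lemma mod_cat_fin_dim: "M \<in> mod_cat K A \<Longrightarrow> vectorspace.fin_dim K (scalar_restriction K A M)"
  by (simp add: mod_cat_def fd_right_module_def)

lemma mod_cat_zero_closed [simp]: "M \<in> mod_cat K A \<Longrightarrow> \<zero>\<^bsub>M\<^esub> \<in> carrier M"
  using mod_cat_abelian_group abelian_group.axioms(1) abelian_monoid.zero_closed by metis

lemma hom_linear_map:
  assumes "M \<in> mod_cat K A" "N \<in> mod_cat K A" "f \<in> module_hom A M N"
  shows "linear_map K (scalar_restriction K A M) (scalar_restriction K A N) f"
proof -
  interpret V: vectorspace K "scalar_restriction K A M" by (rule mod_cat_vectorspace[OF assms(1)])
  interpret W: vectorspace K "scalar_restriction K A N" by (rule mod_cat_vectorspace[OF assms(2)])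
  have "f \<in> module_hom K (scalar_restriction K A M) (scalar_restriction K A N)"
    using assms(3) scalar_in_carrier by (simp add: module_hom_def scalar_restriction_def)
  thus ?thesis
    by (intro linear_map.intro mod_hom.intro mod_hom_axioms.intro
        V.vectorspace_axioms W.vectorspace_axioms V.module_axioms W.module_axioms)
qed

lemma hom_carrier: "f \<in> module_hom A M N \<Longrightarrow> x \<in> carrier M \<Longrightarrow> f x \<in> carrier N"
  using module_hom_closed by blast

lemma hom_zero_map [simp]:
  assumes "M \<in> mod_cat K A" "N \<in> mod_cat K A" "f \<in> module_hom A M N"
  shows "f \<zero>\<^bsub>M\<^esub> = \<zero>\<^bsub>N\<^esub>"
proof -
  interpret T: linear_map K "scalar_restriction K A M" "scalar_restriction K A N" f
    by (rule hom_linear_map[OF assms])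
  show ?thesis using T.T0_is_0 by (simp add: scalar_restriction_def)
qed

lemma hom_comp:
  assumes "f \<in> module_hom A L M" "g \<in> module_hom A M N"
  shows "(\<lambda>x. g (f x)) \<in> module_hom A L N"
proof -
  have "f x \<in> carrier M" if "x \<in> carrier L" for x using that assms(1) by (rule hom_carrier[rotated])
  thus ?thesis using assms by (simp add: module_hom_def Pi_iff)
qed

lemma hom_id: "(\<lambda>x. x) \<in> module_hom A M M"
  by (simp add: module_hom_def)

lemma dimension_surj:
  assumes "M \<in> mod_cat K A" "N \<in> mod_cat K A" "f \<in> module_hom A M N" "f ` carrier M = carrier N"
  shows "dimension N \<le> dimension M" and "dimension N = dimension M \<Longrightarrow> inj_on f (carrier M)"
proof -
  interpret T: linear_map K "scalar_restriction K A M" "scalar_restriction K A N" f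
    by (rule hom_linear_map[OF assms(1-3)])
  have s: "f ` carrier (scalar_restriction K A M) = carrier (scalar_restriction K A N)"
    using assms(4) by (simp add: scalar_restriction_def)
  note * = T.surj_dim[OF mod_cat_fin_dim[OF assms(1)] s]
  show "dimension N \<le> dimension M" "dimension N = dimension M \<Longrightarrow> inj_on f (carrier M)"
    using * by (simp_all add: dimension_def scalar_restriction_def)
qed

lemma is_submodule_subspace:
  assumes M: "M \<in> mod_cat K A" and Y: "is_submodule Y M"
  shows "subspace K Y (scalar_restriction K A M)"
proof -
  interpret V: vectorspace K "scalar_restriction K A M" by (rule mod_cat_vectorspace[OF M])
  have "submodule K Y (scalar_restriction K A M)"
    using Y V.module_axioms scalar_in_carrier
    by (intro submodule.intro) (auto simp: is_submodule_def scalar_restriction_def)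
  thus ?thesis by (intro subspace.intro V.vectorspace_axioms)
qed

lemma submodule_mod_cat:
  assumes M: "M \<in> mod_cat K A" and Y: "is_submodule Y M"
  shows "M\<lparr>carrier := Y\<rparr> \<in> mod_cat K A"
    and "dimension (M\<lparr>carrier := Y\<rparr>) \<le> dimension M"
    and "dimension (M\<lparr>carrier := Y\<rparr>) = dimension M \<Longrightarrow> Y = carrier M"
proof -
  interpret V: vectorspace K "scalar_restriction K A M" by (rule mod_cat_vectorspace[OF M])
  have eq: "scalar_restriction K A (M\<lparr>carrier := Y\<rparr>) = V.vs Y"
    by (simp add: scalar_restriction_def)
  note sub = is_submodule_subspace[OF M Y]
  note * = V.subspace_fin_dim_dim[OF mod_cat_fin_dim[OF M] sub]
  interpret W: vectorspace K "V.vs Y" by (rule V.subspace_is_vs[OF sub])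
  interpret M: right_module A M by (rule mod_cat_right_module[OF M])
  interpret G: abelian_group M by (rule M.abelian_group)
  have "abelian_group (M\<lparr>carrier := Y\<rparr>)"
  proof (rule abelian_groupI)
    fix x assume "x \<in> carrier (M\<lparr>carrier := Y\<rparr>)"
    hence "\<ominus>\<^bsub>V.vs Y\<^esub> x \<in> Y" "\<ominus>\<^bsub>V.vs Y\<^esub> x \<oplus>\<^bsub>M\<^esub> x = \<zero>\<^bsub>M\<^esub>"
      using W.M.a_inv_closed[of x] W.M.l_neg[of x] by (simp_all add: scalar_restriction_def)
    thus "\<exists>y\<in>carrier (M\<lparr>carrier := Y\<rparr>). y \<oplus>\<^bsub>M\<lparr>carrier := Y\<rparr>\<^esub> x = \<zero>\<^bsub>M\<lparr>carrier := Y\<rparr>\<^esub>" by auto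
  qed (use Y G.a_assoc G.a_comm in \<open>auto simp: is_submodule_def subset_iff\<close>)
  hence "right_module A (M\<lparr>carrier := Y\<rparr>)"
    using Y by (intro right_module.intro ring)
      (auto simp: is_submodule_def subset_iff M.act_add_scalar M.act_add M.act_assoc M.act_one)
  thus "M\<lparr>carrier := Y\<rparr> \<in> mod_cat K A"
    using *(1) eq by (simp add: mod_cat_def fd_right_module_def)
  show "dimension (M\<lparr>carrier := Y\<rparr>) \<le> dimension M"
    using *(2) eq by (simp add: dimension_def)
  show "dimension (M\<lparr>carrier := Y\<rparr>) = dimension M \<Longrightarrow> Y = carrier M"
    using *(3) eq by (simp add: dimension_def scalar_restriction_def)
qed

lemma submodule_incl_hom: "Y \<subseteq> carrier M \<Longrightarrow> (\<lambda>x. x) \<in> module_hom A (M\<lparr>carrier := Y\<rparr>) M"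
  by (auto simp: module_hom_def)

lemma hom_image_submodule:
  assumes "M \<in> mod_cat K A" "N \<in> mod_cat K A" "f \<in> module_hom A M N"
  shows "is_submodule (f ` carrier M) N"
proof -
  interpret M: right_module A M by (rule mod_cat_right_module[OF assms(1)])
  interpret G: abelian_group M by (rule M.abelian_group)
  have "f x \<oplus>\<^bsub>N\<^esub> f y \<in> f ` carrier M" if "x \<in> carrier M" "y \<in> carrier M" for x y
    using module_hom_add[OF assms(3) that] that by (metis G.a_closed image_eqI)
  moreover have "a \<odot>\<^bsub>N\<^esub> f x \<in> f ` carrier M" if "a \<in> carrier A" "x \<in> carrier M" for a x
    using module_hom_smult[OF assms(3) that] that by (metis M.act_closed image_eqI)
  moreover have "\<zero>\<^bsub>N\<^esub> \<in> f ` carrier M"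
    using hom_zero_map[OF assms] by (metis G.zero_closed image_eqI)
  ultimately show ?thesis using hom_carrier[OF assms(3)] by (auto simp: is_submodule_def)
qed

lemma hom_onto_image: "f \<in> module_hom A M N \<Longrightarrow> f \<in> module_hom A M (N\<lparr>carrier := f ` carrier M\<rparr>)"
  by (auto simp: module_hom_def)

lemma hom_zero_iff_image:
  assumes "M \<in> mod_cat K A" "N \<in> mod_cat K A"
  shows "hom_zero A M N \<longleftrightarrow> (\<forall>f \<in> module_hom A M N. f ` carrier M = {\<zero>\<^bsub>N\<^esub>})"
proof -
  have "carrier M \<noteq> {}" using mod_cat_zero_closed[OF assms(1)] by blast
  hence "(\<forall>x\<in>carrier M. f x = \<zero>\<^bsub>N\<^esub>) \<longleftrightarrow> f ` carrier M = {\<zero>\<^bsub>N\<^esub>}" for f by auto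
  thus ?thesis by (simp add: hom_zero_def)
qed

lemma hom_diff:
  assumes "M \<in> mod_cat K A" "N \<in> mod_cat K A" "f \<in> module_hom A M N" "x \<in> carrier M" "y \<in> carrier M"
  shows "f (x \<ominus>\<^bsub>M\<^esub> y) = f x \<ominus>\<^bsub>N\<^esub> f y"
proof -
  interpret G: abelian_group M by (rule mod_cat_abelian_group[OF assms(1)])
  interpret H: abelian_group N by (rule mod_cat_abelian_group[OF assms(2)])
  have c: "f x \<in> carrier N" "f y \<in> carrier N" "f (\<ominus>\<^bsub>M\<^esub> y) \<in> carrier N"
    using assms by (auto intro!: hom_carrier[OF assms(3)])
  have "f (\<ominus>\<^bsub>M\<^esub> y) \<oplus>\<^bsub>N\<^esub> f y = \<zero>\<^bsub>N\<^esub>"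
    using module_hom_add[OF assms(3), of "\<ominus>\<^bsub>M\<^esub> y" y] assms(5) hom_zero_map[OF assms(1-3)]
    by (simp add: G.l_neg)
  hence "f (\<ominus>\<^bsub>M\<^esub> y) = \<ominus>\<^bsub>N\<^esub> f y"
    using c H.minus_equality by metis
  thus ?thesis using module_hom_add[OF assms(3), of x "\<ominus>\<^bsub>M\<^esub> y"] assms(4,5)
    by (simp add: a_minus_def)
qed

text \<open>Universal property of the quotient map \<open>g\<close>: two preimages of a point differ
  by an element of the kernel of \<open>g\<close>, which \<open>h\<close> kills, so every choice of
  preimage gives the same value.\<close>

lemma hom_factor:
  assumes X: "X \<in> mod_cat K A" and N: "N \<in> mod_cat K A" and S: "S \<in> mod_cat K A"
    and g: "g \<in> module_hom A X N" "g ` carrier X = carrier N"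
    and h: "h \<in> module_hom A X S"
    and ker: "\<And>x. x \<in> carrier X \<Longrightarrow> g x = \<zero>\<^bsub>N\<^esub> \<Longrightarrow> h x = \<zero>\<^bsub>S\<^esub>"
  shows "\<exists>k \<in> module_hom A N S. \<forall>x \<in> carrier X. k (g x) = h x"
proof -
  interpret X: right_module A X by (rule mod_cat_right_module[OF X])
  interpret GX: abelian_group X by (rule X.abelian_group)
  interpret GN: abelian_group N by (rule mod_cat_abelian_group[OF N])
  interpret GS: abelian_group S by (rule mod_cat_abelian_group[OF S])
  have wd: "h x = h y" if "x \<in> carrier X" "y \<in> carrier X" "g x = g y" for x y
  proof -
    have "g (x \<ominus>\<^bsub>X\<^esub> y) = \<zero>\<^bsub>N\<^esub>"
      using hom_diff[OF X N g(1) that(1,2)] that hom_carrier[OF g(1)]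
      by (simp add: GN.minus_eq GN.r_neg)
    hence "h x \<ominus>\<^bsub>S\<^esub> h y = \<zero>\<^bsub>S\<^esub>" using hom_diff[OF X S h that(1,2)] ker that by simp
    moreover have "h x = (h x \<ominus>\<^bsub>S\<^esub> h y) \<oplus>\<^bsub>S\<^esub> h y"
      using that hom_carrier[OF h] by (simp add: GS.minus_eq GS.a_assoc GS.l_neg)
    ultimately show ?thesis using that hom_carrier[OF h] by simp
  qed
  define k where "k n = h (inv_into (carrier X) g n)" for n
  have kg: "k (g x) = h x" if "x \<in> carrier X" for x
  proof -
    have "g x \<in> g ` carrier X" using that by simp
    thus ?thesis unfolding k_def using wd that f_inv_into_f inv_into_into by metis
  qed
  have "k \<in> module_hom A N S"
    unfolding module_hom_def g(2)[symmetric]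
    using hom_carrier[OF h] module_hom_add[OF g(1), symmetric] module_hom_smult[OF g(1), symmetric]
    by (auto simp: kg module_hom_add[OF h] module_hom_smult[OF h] X.act_closed)
  thus ?thesis using kg by blast
qed

text \<open>The quotient is realised on a set of coset representatives, so that it has elements in the
  same type as \<open>M\<close>.\<close>

lemma quotient_exists:
  assumes M: "M \<in> mod_cat K A" and Y: "is_submodule Y M"
  shows "\<exists>N \<in> mod_cat K A. \<exists>g \<in> module_hom A M N. g ` carrier M = carrier N \<and>
    {x \<in> carrier M. g x = \<zero>\<^bsub>N\<^esub>} = Y"
proof -
  interpret M: right_module A M by (rule mod_cat_right_module[OF M])
  interpret G: abelian_group M by (rule M.abelian_group)
  have YM: "Y \<subseteq> carrier M" "\<zero>\<^bsub>M\<^esub> \<in> Y" and add: "\<And>x y. x \<in> Y \<Longrightarrow> y \<in> Y \<Longrightarrow> x \<oplus>\<^bsub>M\<^esub> y \<in> Y"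
    and act: "\<And>a x. a \<in> carrier A \<Longrightarrow> x \<in> Y \<Longrightarrow> a \<odot>\<^bsub>M\<^esub> x \<in> Y"
    using Y by (auto simp: is_submodule_def)
  interpret MY: abelian_group "M\<lparr>carrier := Y\<rparr>"
    by (rule mod_cat_abelian_group[OF submodule_mod_cat(1)[OF M Y]])
  have neg: "\<ominus>\<^bsub>M\<^esub> x \<in> Y" if xY: "x \<in> Y" for x
  proof -
    obtain y where y: "y \<in> Y" "y \<oplus>\<^bsub>M\<^esub> x = \<zero>\<^bsub>M\<^esub>" using MY.l_neg[of x] MY.a_inv_closed[of x] xY by auto
    have "\<ominus>\<^bsub>M\<^esub> x = y" by (rule G.minus_equality[OF y(2)]) (use xY y YM(1) in auto)
    thus ?thesis using y(1) by simp
  qed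
  \<comment> \<open>The predicate says that \<open>y\<close> lies in the coset of \<open>x\<close>
    modulo \<open>Y\<close>. It depends on \<open>x\<close> only through this coset, so
    \<open>SOME\<close> picks one representative per coset; this is \<open>rep_shift\<close>
    below.\<close>
  define rep where "rep x = (SOME y. y \<in> carrier M \<and> (\<exists>z\<in>Y. x = y \<oplus>\<^bsub>M\<^esub> z))" for x
  have rep: "rep x \<in> carrier M" "\<exists>z\<in>Y. x = rep x \<oplus>\<^bsub>M\<^esub> z" if "x \<in> carrier M" for x
  proof -
    have "x \<in> carrier M \<and> (\<exists>z\<in>Y. x = x \<oplus>\<^bsub>M\<^esub> z)" using that YM(2) by force
    from someI[where P="\<lambda>y. y \<in> carrier M \<and> (\<exists>z\<in>Y. x = y \<oplus>\<^bsub>M\<^esub> z)", OF this]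
    show "rep x \<in> carrier M" "\<exists>z\<in>Y. x = rep x \<oplus>\<^bsub>M\<^esub> z" by (simp_all add: rep_def)
  qed
  have rep_shift: "rep (x \<oplus>\<^bsub>M\<^esub> z) = rep x" if "x \<in> carrier M" "z \<in> Y" for x z
  proof -
    have "(\<exists>w\<in>Y. x \<oplus>\<^bsub>M\<^esub> z = y \<oplus>\<^bsub>M\<^esub> w) \<longleftrightarrow> (\<exists>w\<in>Y. x = y \<oplus>\<^bsub>M\<^esub> w)" if y: "y \<in> carrier M" for y
    proof
      assume "\<exists>w\<in>Y. x \<oplus>\<^bsub>M\<^esub> z = y \<oplus>\<^bsub>M\<^esub> w"
      then obtain w where w: "w \<in> Y" "x \<oplus>\<^bsub>M\<^esub> z = y \<oplus>\<^bsub>M\<^esub> w" by blast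
      have c: "z \<in> carrier M" "w \<in> carrier M" "\<ominus>\<^bsub>M\<^esub> z \<in> carrier M" using w(1) \<open>z \<in> Y\<close> YM(1) by auto
      have "x = (x \<oplus>\<^bsub>M\<^esub> z) \<oplus>\<^bsub>M\<^esub> \<ominus>\<^bsub>M\<^esub> z" using c \<open>x \<in> carrier M\<close> by (simp add: G.a_assoc G.r_neg)
      also have "\<dots> = y \<oplus>\<^bsub>M\<^esub> (w \<oplus>\<^bsub>M\<^esub> \<ominus>\<^bsub>M\<^esub> z)" using c y w(2) by (simp add: G.a_assoc)
      finally show "\<exists>w\<in>Y. x = y \<oplus>\<^bsub>M\<^esub> w" using add[OF w(1) neg[OF \<open>z \<in> Y\<close>]] by blast
    next
      assume "\<exists>w\<in>Y. x = y \<oplus>\<^bsub>M\<^esub> w"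
      then obtain w where w: "w \<in> Y" "x = y \<oplus>\<^bsub>M\<^esub> w" by blast
      have "z \<in> carrier M" "w \<in> carrier M" using w(1) \<open>z \<in> Y\<close> YM(1) by auto
      hence "x \<oplus>\<^bsub>M\<^esub> z = y \<oplus>\<^bsub>M\<^esub> (w \<oplus>\<^bsub>M\<^esub> z)" using w(2) y by (simp add: G.a_assoc)
      thus "\<exists>w\<in>Y. x \<oplus>\<^bsub>M\<^esub> z = y \<oplus>\<^bsub>M\<^esub> w" using add[OF w(1) \<open>z \<in> Y\<close>] by blast
    qed
    hence "(\<lambda>y. y \<in> carrier M \<and> (\<exists>w\<in>Y. x \<oplus>\<^bsub>M\<^esub> z = y \<oplus>\<^bsub>M\<^esub> w)) =
      (\<lambda>y. y \<in> carrier M \<and> (\<exists>w\<in>Y. x = y \<oplus>\<^bsub>M\<^esub> w))" by (intro ext conj_cong refl)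
    thus ?thesis by (simp only: rep_def)
  qed
  have rep_rep [simp]: "rep (rep x) = rep x" if "x \<in> carrier M" for x
    using rep[OF that] rep_shift by metis
  have rep_add [simp]: "rep (rep x \<oplus>\<^bsub>M\<^esub> y) = rep (x \<oplus>\<^bsub>M\<^esub> y)"
    if xy: "x \<in> carrier M" "y \<in> carrier M" for x y
  proof -
    obtain z where z: "z \<in> Y" "x = rep x \<oplus>\<^bsub>M\<^esub> z" using rep(2)[OF xy(1)] by blast
    have zc: "z \<in> carrier M" using z(1) YM(1) by blast
    have "x \<oplus>\<^bsub>M\<^esub> y = (rep x \<oplus>\<^bsub>M\<^esub> z) \<oplus>\<^bsub>M\<^esub> y" using z(2) by simp
    also have "\<dots> = (rep x \<oplus>\<^bsub>M\<^esub> y) \<oplus>\<^bsub>M\<^esub> z"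
      using rep(1)[OF xy(1)] zc xy(2) by (simp add: G.a_ac)
    finally show ?thesis
      using rep_shift[of "rep x \<oplus>\<^bsub>M\<^esub> y" z] rep(1)[OF xy(1)] z(1) xy by simp
  qed
  have rep_add' [simp]: "rep (y \<oplus>\<^bsub>M\<^esub> rep x) = rep (y \<oplus>\<^bsub>M\<^esub> x)"
    if "x \<in> carrier M" "y \<in> carrier M" for x y
    using rep_add[OF that] rep(1)[OF that(1)] that G.a_comm by metis
  have rep_act [simp]: "rep (a \<odot>\<^bsub>M\<^esub> rep x) = rep (a \<odot>\<^bsub>M\<^esub> x)"
    if ax: "a \<in> carrier A" "x \<in> carrier M" for a x
  proof -
    obtain z where z: "z \<in> Y" "x = rep x \<oplus>\<^bsub>M\<^esub> z" using rep(2)[OF ax(2)] by blast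
    have "a \<odot>\<^bsub>M\<^esub> x = a \<odot>\<^bsub>M\<^esub> rep x \<oplus>\<^bsub>M\<^esub> a \<odot>\<^bsub>M\<^esub> z"
      using z YM(1) M.act_add[OF ax(1) rep(1)[OF ax(2)], of z] by auto
    thus ?thesis using rep_shift act[OF ax(1) z(1)] M.act_closed ax rep(1) by simp
  qed
  note [simp] = rep(1) M.act_closed
  \<comment> \<open>Operations are carried out in \<open>M\<close> and followed by
    \<open>rep\<close>. The simplification rules \<open>rep_add\<close>, \<open>rep_add'\<close> and
    \<open>rep_act\<close> remove inner occurrences of \<open>rep\<close>, which reduces the module
    axioms to those of \<open>M\<close>.\<close>
  define N where "N = \<lparr>carrier = rep ` carrier M, mult = (\<lambda>u v. u), one = rep \<zero>\<^bsub>M\<^esub>,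
    zero = rep \<zero>\<^bsub>M\<^esub>, add = (\<lambda>u v. rep (u \<oplus>\<^bsub>M\<^esub> v)), smult = (\<lambda>a u. rep (a \<odot>\<^bsub>M\<^esub> u))\<rparr>"
  have abN: "abelian_group N"
  proof (rule abelian_groupI)
    fix u assume "u \<in> carrier N"
    then obtain x where "x \<in> carrier M" "u = rep x" by (auto simp: N_def)
    thus "\<exists>v\<in>carrier N. v \<oplus>\<^bsub>N\<^esub> u = \<zero>\<^bsub>N\<^esub>"
      by (intro bexI[of _ "rep (\<ominus>\<^bsub>M\<^esub> x)"]) (auto simp: N_def G.l_neg)
  qed (auto simp: N_def, simp_all add: G.a_ac)
  have rmN: "right_module A N"
    by (rule right_module.intro[OF ring abN], auto simp: N_def)
      (simp_all add: M.act_add_scalar M.act_add M.act_assoc M.act_one)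
  have hom: "rep \<in> module_hom A M N"
    by (auto simp: module_hom_def N_def)
  have surj: "rep ` carrier M = carrier N" by (simp add: N_def)
  have ker: "{x \<in> carrier M. rep x = \<zero>\<^bsub>N\<^esub>} = Y"
  proof (intro equalityI subsetI)
    fix x assume "x \<in> {x \<in> carrier M. rep x = \<zero>\<^bsub>N\<^esub>}"
    hence x: "x \<in> carrier M" "rep x = rep \<zero>\<^bsub>M\<^esub>" by (auto simp: N_def)
    obtain z where z: "z \<in> Y" "x = rep x \<oplus>\<^bsub>M\<^esub> z" using rep(2)[OF x(1)] by blast
    \<comment> \<open>The representative of zero need not be zero; it is only known to be the
      negative of some \<open>w\<close> in \<open>Y\<close>.\<close>
    obtain w where w: "w \<in> Y" "\<zero>\<^bsub>M\<^esub> = rep \<zero>\<^bsub>M\<^esub> \<oplus>\<^bsub>M\<^esub> w" using rep(2)[of "\<zero>\<^bsub>M\<^esub>"] by auto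
    have "rep \<zero>\<^bsub>M\<^esub> = \<ominus>\<^bsub>M\<^esub> w" using w YM(1) G.minus_equality[of "rep \<zero>\<^bsub>M\<^esub>" w] by auto
    thus "x \<in> Y" using x(2) z add neg[OF w(1)] by metis
  next
    fix x assume "x \<in> Y"
    thus "x \<in> {x \<in> carrier M. rep x = \<zero>\<^bsub>N\<^esub>}"
      using rep_shift[of "\<zero>\<^bsub>M\<^esub>" x] YM(1) by (auto simp: N_def)
  qed
  interpret V: vectorspace K "scalar_restriction K A M" by (rule mod_cat_vectorspace[OF M])
  interpret W: vectorspace K "scalar_restriction K A N"
    by (rule vectorspace_scalar_restriction[OF rmN])
  have "rep \<in> module_hom K (scalar_restriction K A M) (scalar_restriction K A N)"
    using hom scalar_in_carrier by (simp add: module_hom_def scalar_restriction_def)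
  then interpret T: linear_map K "scalar_restriction K A M" "scalar_restriction K A N" rep
    by (intro linear_map.intro mod_hom.intro mod_hom_axioms.intro
        V.vectorspace_axioms W.vectorspace_axioms V.module_axioms W.module_axioms)
  have "W.fin_dim"
    by (rule T.rank_nullity_main(2)[OF mod_cat_fin_dim[OF M]])
      (simp add: scalar_restriction_def surj)
  hence "N \<in> mod_cat K A" using rmN by (simp add: mod_cat_def fd_right_module_def)
  thus ?thesis using hom surj ker by blast
qed


section \<open>Torsion classes and bricks\<close>


lemma torsion_mod_cat: "torsion_class K A T \<Longrightarrow> M \<in> T \<Longrightarrow> M \<in> mod_cat K A"
  unfolding torsion_class_def by (rule subsetD[OF conjunct1])

lemma torsion_zero:
  "torsion_class K A T \<Longrightarrow> M \<in> mod_cat K A \<Longrightarrow> carrier M = {\<zero>\<^bsub>M\<^esub>} \<Longrightarrow> M \<in> T"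
  unfolding torsion_class_def by (drule conjunct2, drule conjunct1) simp

lemma torsion_quotient:
  assumes "torsion_class K A T" "M \<in> T" "N \<in> mod_cat K A"
    and "f \<in> module_hom A M N" "f ` carrier M = carrier N"
  shows "N \<in> T"
proof -
  have "\<forall>M \<in> T. \<forall>N \<in> mod_cat K A.
      (\<exists>f \<in> module_hom A M N. f ` carrier M = carrier N) \<longrightarrow> N \<in> T"
    using assms(1) unfolding torsion_class_def by (elim conjE)
  thus ?thesis using assms(2-5) by blast
qed

lemma torsion_extension:
  assumes "torsion_class K A T" "L \<in> T" "N \<in> T" "M \<in> mod_cat K A" "short_exact A L M N"
  shows "M \<in> T"
proof -
  have "\<forall>L \<in> T. \<forall>N \<in> T. \<forall>M \<in> mod_cat K A. short_exact A L M N \<longrightarrow> M \<in> T"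
    using assms(1) unfolding torsion_class_def by (elim conjE)
  thus ?thesis using assms(2-5) by blast
qed

lemma torsion_image:
  assumes "torsion_class K A T" "L \<in> T" "M \<in> mod_cat K A" "f \<in> module_hom A L M"
  shows "M\<lparr>carrier := f ` carrier L\<rparr> \<in> T"
proof (rule torsion_quotient[OF assms(1,2)])
  have "L \<in> mod_cat K A" by (rule torsion_mod_cat[OF assms(1,2)])
  thus "M\<lparr>carrier := f ` carrier L\<rparr> \<in> mod_cat K A"
    using submodule_mod_cat(1) hom_image_submodule assms(3,4) by blast
  show "f \<in> module_hom A L (M\<lparr>carrier := f ` carrier L\<rparr>)" by (rule hom_onto_image[OF assms(4)])
qed simp

lemma short_exact_submodule:
  assumes "Y \<subseteq> carrier M" "g \<in> module_hom A M N" "g ` carrier M = carrier N"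
    and "{x \<in> carrier M. g x = \<zero>\<^bsub>N\<^esub>} = Y"
  shows "short_exact A (M\<lparr>carrier := Y\<rparr>) M N"
  unfolding short_exact_def
proof (rule bexI[of _ "\<lambda>x. x"], rule bexI[of _ g], intro conjI)
  show "(\<lambda>x. x) ` carrier (M\<lparr>carrier := Y\<rparr>) = {x \<in> carrier M. g x = \<zero>\<^bsub>N\<^esub>}"
    using assms(4) by simp
qed (use assms submodule_incl_hom[OF assms(1)] in simp_all)

text \<open>The parameter \<open>b\<close> yields two torsion classes at once: for
  \<open>False\<close> the modules without nonzero maps to \<open>S\<close>, for \<open>True\<close>
  those whose nonzero maps to \<open>S\<close> are onto. On the middle term of an extension, a map
  \<open>h\<close> either vanishes on the submodule and factors through the quotient, or is already
  onto on the submodule.\<close>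

lemma torsion_class_image_cond:
  assumes S: "S \<in> mod_cat K A"
  shows "torsion_class K A {X \<in> mod_cat K A. \<forall>h \<in> module_hom A X S.
    h ` carrier X = {\<zero>\<^bsub>S\<^esub>} \<or> (b \<and> h ` carrier X = carrier S)}"
    (is "torsion_class K A ?W")
proof -
  have zero: "M \<in> ?W" if "M \<in> mod_cat K A" "carrier M = {\<zero>\<^bsub>M\<^esub>}" for M
    using that hom_zero_map[OF that(1) S] by auto
  have quot: "N \<in> ?W" if M: "M \<in> ?W" and N: "N \<in> mod_cat K A"
    and f: "f \<in> module_hom A M N" "f ` carrier M = carrier N" for M N f
  proof -
    have "h ` carrier N = {\<zero>\<^bsub>S\<^esub>} \<or> (b \<and> h ` carrier N = carrier S)"
      if h: "h \<in> module_hom A N S" for h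
    proof -
      have "h ` carrier N = (\<lambda>x. h (f x)) ` carrier M" by (simp only: f(2)[symmetric] image_image)
      thus ?thesis using M hom_comp[OF f(1) h] by auto
    qed
    thus ?thesis using N by blast
  qed
  have ext: "M \<in> ?W" if L: "L \<in> ?W" and N: "N \<in> ?W" and M: "M \<in> mod_cat K A"
    and LMN: "short_exact A L M N" for L M N
  proof -
    from LMN obtain f g where fg: "f \<in> module_hom A L M" "g \<in> module_hom A M N"
        "f ` carrier L = {x \<in> carrier M. g x = \<zero>\<^bsub>N\<^esub>}" "g ` carrier M = carrier N"
      unfolding short_exact_def by blast
    have "h ` carrier M = {\<zero>\<^bsub>S\<^esub>} \<or> (b \<and> h ` carrier M = carrier S)"
      if h: "h \<in> module_hom A M S" for h
    proof -
      have im: "(\<lambda>x. h (f x)) ` carrier L = h ` f ` carrier L" by (simp only: image_image)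
      have "\<forall>k \<in> module_hom A L S. k ` carrier L = {\<zero>\<^bsub>S\<^esub>} \<or> (b \<and> k ` carrier L = carrier S)"
        using L by simp
      from bspec[OF this hom_comp[OF fg(1) h]]
      have "h ` f ` carrier L = {\<zero>\<^bsub>S\<^esub>} \<or> (b \<and> h ` f ` carrier L = carrier S)"
        by (simp only: im)
      thus ?thesis
      proof
        assume "h ` f ` carrier L = {\<zero>\<^bsub>S\<^esub>}"
        hence ker: "h x = \<zero>\<^bsub>S\<^esub>" if "x \<in> carrier M" "g x = \<zero>\<^bsub>N\<^esub>" for x
          using fg(3) that by blast
        obtain k where k: "k \<in> module_hom A N S" "\<forall>x \<in> carrier M. k (g x) = h x"
          using hom_factor[OF M _ S fg(2,4) h ker] N by blast
        have "h ` carrier M = k ` carrier N"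
          unfolding fg(4)[symmetric] image_image using k(2) by (intro image_cong) auto
        thus ?thesis using N k(1) by auto
      next
        assume *: "b \<and> h ` f ` carrier L = carrier S"
        have "f ` carrier L \<subseteq> carrier M" using fg(3) by blast
        hence "carrier S \<subseteq> h ` carrier M" using * by blast
        thus ?thesis using * hom_carrier[OF h] by blast
      qed
    qed
    thus ?thesis using M by blast
  qed
  show ?thesis unfolding torsion_class_def
    by (intro conjI ballI impI) (blast, erule (1) zero, elim bexE, erule (3) quot, erule (3) ext)
qed

lemma hom_zeroD:
  "hom_zero A M N \<Longrightarrow> f \<in> module_hom A M N \<Longrightarrow> x \<in> carrier M \<Longrightarrow> f x = \<zero>\<^bsub>N\<^esub>"
  by (simp add: hom_zero_def)

lemma torsion_class_hom_zero:
  assumes S: "S \<in> mod_cat K A"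
  shows "torsion_class K A {X \<in> mod_cat K A. hom_zero A X S}"
proof -
  have "{X \<in> mod_cat K A. hom_zero A X S} = {X \<in> mod_cat K A. \<forall>h \<in> module_hom A X S.
    h ` carrier X = {\<zero>\<^bsub>S\<^esub>} \<or> (False \<and> h ` carrier X = carrier S)}"
    using hom_zero_iff_image[OF _ S] by auto
  thus ?thesis using torsion_class_image_cond[OF S, of False] by simp
qed

section \<open>Endomorphism rings and bricks\<close>

lemma End_ring_ring:
  assumes M: "M \<in> mod_cat K A"
  shows "ring (End_ring A M)"
proof -
  interpret M: right_module A M by (rule mod_cat_right_module[OF M])
  interpret G: abelian_group M by (rule M.abelian_group)
  note [simp] = M.act_closed M.act_add
  let ?E = "End_ring A M"
  have carr: "f \<in> carrier ?E \<longleftrightarrow> f \<in> module_hom A M M \<and> f \<in> extensional (carrier M)" for f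
    by (simp add: End_ring_def)
  have homI: "f \<in> module_hom A M M" if "\<And>x. x \<in> carrier M \<Longrightarrow> f x \<in> carrier M"
    "\<And>x y. x \<in> carrier M \<Longrightarrow> y \<in> carrier M \<Longrightarrow> f (x \<oplus>\<^bsub>M\<^esub> y) = f x \<oplus>\<^bsub>M\<^esub> f y"
    "\<And>a x. a \<in> carrier A \<Longrightarrow> x \<in> carrier M \<Longrightarrow> f (a \<odot>\<^bsub>M\<^esub> x) = a \<odot>\<^bsub>M\<^esub> f x" for f
    using that by (simp add: module_hom_def)
  \<comment> \<open>Ring elements are extensional, so the ring identities below can be checked
    pointwise on \<open>carrier M\<close>.\<close>
  have eqI: "f = g" if "f \<in> carrier ?E" "g \<in> carrier ?E"
    "\<And>x. x \<in> carrier M \<Longrightarrow> f x = g x" for f g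
    using that unfolding carr by (metis extensionalityI)
  have actneg: "a \<odot>\<^bsub>M\<^esub> (\<ominus>\<^bsub>M\<^esub> x) = \<ominus>\<^bsub>M\<^esub> (a \<odot>\<^bsub>M\<^esub> x)" if "a \<in> carrier A" "x \<in> carrier M" for a x
    using M.act_add[OF that(1), of "\<ominus>\<^bsub>M\<^esub> x" x] that M.act_zero
    by (metis G.a_inv_closed G.l_neg G.minus_equality M.act_closed)
  have hc: "f x \<in> carrier M" if "f \<in> carrier ?E" "x \<in> carrier M" for f x
    using that unfolding carr by (meson hom_carrier)
  have ha: "f (x \<oplus>\<^bsub>M\<^esub> y) = f x \<oplus>\<^bsub>M\<^esub> f y"
    if "f \<in> carrier ?E" "x \<in> carrier M" "y \<in> carrier M" for f x y
    using that unfolding carr by (meson module_hom_add)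
  have hs: "f (a \<odot>\<^bsub>M\<^esub> x) = a \<odot>\<^bsub>M\<^esub> f x"
    if "f \<in> carrier ?E" "a \<in> carrier A" "x \<in> carrier M" for f a x
    using that unfolding carr by (meson module_hom_smult)
  have add: "(f \<oplus>\<^bsub>?E\<^esub> g) x = f x \<oplus>\<^bsub>M\<^esub> g x" if "x \<in> carrier M" for f g x
    using that by (simp add: End_ring_def)
  have mult: "(f \<otimes>\<^bsub>?E\<^esub> g) x = f (g x)" if "x \<in> carrier M" for f g x
    using that by (simp add: End_ring_def compose_def)
  have zero: "\<zero>\<^bsub>?E\<^esub> x = \<zero>\<^bsub>M\<^esub>" and one: "\<one>\<^bsub>?E\<^esub> x = x" if "x \<in> carrier M" for x
    using that by (simp_all add: End_ring_def)
  have ext: "f \<oplus>\<^bsub>?E\<^esub> g \<in> extensional (carrier M)" "f \<otimes>\<^bsub>?E\<^esub> g \<in> extensional (carrier M)"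
    "\<zero>\<^bsub>?E\<^esub> \<in> extensional (carrier M)" "\<one>\<^bsub>?E\<^esub> \<in> extensional (carrier M)" for f g
    by (simp_all add: End_ring_def compose_def)
  have addc: "f \<oplus>\<^bsub>?E\<^esub> g \<in> carrier ?E" if "f \<in> carrier ?E" "g \<in> carrier ?E" for f g
    unfolding carr
    by (intro conjI ext homI)
      (simp_all add: add hc[OF that(1)] hc[OF that(2)] ha[OF that(1)] ha[OF that(2)]
        hs[OF that(1)] hs[OF that(2)] G.a_ac)
  have multc: "f \<otimes>\<^bsub>?E\<^esub> g \<in> carrier ?E" if "f \<in> carrier ?E" "g \<in> carrier ?E" for f g
    unfolding carr
    by (intro conjI ext homI)
      (simp_all add: mult hc[OF that(1)] hc[OF that(2)] ha[OF that(1)] ha[OF that(2)]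
        hs[OF that(1)] hs[OF that(2)])
  have zeroc: "\<zero>\<^bsub>?E\<^esub> \<in> carrier ?E" and onec: "\<one>\<^bsub>?E\<^esub> \<in> carrier ?E"
    unfolding carr by (intro conjI ext homI; simp add: zero one M.act_zero)+
  have ab: "abelian_group ?E"
  proof (rule abelian_groupI)
    fix f assume f: "f \<in> carrier ?E"
    let ?g = "\<lambda>x \<in> carrier M. \<ominus>\<^bsub>M\<^esub> f x"
    have g: "?g \<in> carrier ?E"
      unfolding carr by (intro conjI homI restrict_extensional)
        (simp_all add: hc[OF f] ha[OF f] hs[OF f] G.minus_add actneg)
    have "?g \<oplus>\<^bsub>?E\<^esub> f = \<zero>\<^bsub>?E\<^esub>"
      by (rule eqI[OF addc[OF g f] zeroc]) (simp add: add zero hc[OF f] G.l_neg)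
    thus "\<exists>g\<in>carrier ?E. g \<oplus>\<^bsub>?E\<^esub> f = \<zero>\<^bsub>?E\<^esub>" using g by (rule bexI)
    show "\<zero>\<^bsub>?E\<^esub> \<oplus>\<^bsub>?E\<^esub> f = f"
      by (rule eqI[OF addc[OF zeroc f] f]) (simp add: add zero hc[OF f])
    fix g assume g: "g \<in> carrier ?E"
    show "f \<oplus>\<^bsub>?E\<^esub> g \<in> carrier ?E" by (rule addc[OF f g])
    show "f \<oplus>\<^bsub>?E\<^esub> g = g \<oplus>\<^bsub>?E\<^esub> f"
      by (rule eqI[OF addc[OF f g] addc[OF g f]]) (simp add: add hc[OF f] hc[OF g] G.a_comm)
    fix h assume h: "h \<in> carrier ?E"
    show "f \<oplus>\<^bsub>?E\<^esub> g \<oplus>\<^bsub>?E\<^esub> h = f \<oplus>\<^bsub>?E\<^esub> (g \<oplus>\<^bsub>?E\<^esub> h)"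
      by (rule eqI[OF addc[OF addc[OF f g] h] addc[OF f addc[OF g h]]])
        (simp add: add hc[OF f] hc[OF g] hc[OF h] G.a_assoc)
  qed (rule zeroc)
  have mon: "monoid ?E"
  proof (rule monoidI)
    fix f assume f: "f \<in> carrier ?E"
    show "\<one>\<^bsub>?E\<^esub> \<otimes>\<^bsub>?E\<^esub> f = f" "f \<otimes>\<^bsub>?E\<^esub> \<one>\<^bsub>?E\<^esub> = f"
      by (rule eqI[OF multc[OF onec f] f] eqI[OF multc[OF f onec] f],
          simp add: mult one hc[OF f])+
    fix g assume g: "g \<in> carrier ?E"
    show "f \<otimes>\<^bsub>?E\<^esub> g \<in> carrier ?E" by (rule multc[OF f g])
    fix h assume h: "h \<in> carrier ?E"
    show "f \<otimes>\<^bsub>?E\<^esub> g \<otimes>\<^bsub>?E\<^esub> h = f \<otimes>\<^bsub>?E\<^esub> (g \<otimes>\<^bsub>?E\<^esub> h)"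
      by (rule eqI[OF multc[OF multc[OF f g] h] multc[OF f multc[OF g h]]])
        (simp add: mult hc[OF h])
  qed (rule onec)
  show ?thesis
  proof (rule ringI[OF ab mon])
    fix f g h assume f: "f \<in> carrier ?E" and g: "g \<in> carrier ?E" and h: "h \<in> carrier ?E"
    show "(f \<oplus>\<^bsub>?E\<^esub> g) \<otimes>\<^bsub>?E\<^esub> h = f \<otimes>\<^bsub>?E\<^esub> h \<oplus>\<^bsub>?E\<^esub> g \<otimes>\<^bsub>?E\<^esub> h"
      by (rule eqI[OF multc[OF addc[OF f g] h] addc[OF multc[OF f h] multc[OF g h]]])
        (simp add: add mult hc[OF h])
    show "h \<otimes>\<^bsub>?E\<^esub> (f \<oplus>\<^bsub>?E\<^esub> g) = h \<otimes>\<^bsub>?E\<^esub> f \<oplus>\<^bsub>?E\<^esub> h \<otimes>\<^bsub>?E\<^esub> g"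
      by (rule eqI[OF multc[OF h addc[OF f g]] addc[OF multc[OF h f] multc[OF h g]]])
        (simp add: add mult hc[OF f] hc[OF g] ha[OF h])
  qed
qed

lemma hom_inverse:
  assumes "M \<in> mod_cat K A" "f \<in> module_hom A M N" "bij_betw f (carrier M) (carrier N)"
  shows "inv_into (carrier M) f \<in> module_hom A N M"
proof -
  interpret M: right_module A M by (rule mod_cat_right_module[OF assms(1)])
  interpret G: abelian_group M by (rule M.abelian_group)
  have s: "carrier N = f ` carrier M" and i: "inj_on f (carrier M)"
    using assms(3) by (auto simp: bij_betw_def)
  show ?thesis
    unfolding module_hom_def s
    using i module_hom_add[OF assms(2), symmetric] module_hom_smult[OF assms(2), symmetric]
    by (auto simp: M.act_closed)
qed

text \<open>A surjective endomorphism of a finite-dimensional module is bijective, so being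
  invertible amounts to being onto. This form speaks of images only, as does
  \<open>torsion_class_image_cond\<close>.\<close>

lemma brick_iff:
  "brick K A M \<longleftrightarrow> M \<in> mod_cat K A \<and> carrier M \<noteq> {\<zero>\<^bsub>M\<^esub>} \<and>
    (\<forall>f \<in> module_hom A M M. f ` carrier M = {\<zero>\<^bsub>M\<^esub>} \<or> f ` carrier M = carrier M)"
  (is "_ \<longleftrightarrow> ?rhs")
proof
  assume B: "brick K A M"
  hence M: "M \<in> mod_cat K A" and sk: "skew_field (End_ring A M)" by (auto simp: brick_def)
  interpret E: skew_field "End_ring A M" by (rule sk)
  have "carrier M \<noteq> {\<zero>\<^bsub>M\<^esub>}"
  proof
    assume *: "carrier M = {\<zero>\<^bsub>M\<^esub>}"
    have "hom_zero A M M" unfolding hom_zero_def using hom_carrier[of _ M M] * by blast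
    thus False using brick_not_hom_zero[OF B] by blast
  qed
  moreover have "f ` carrier M = {\<zero>\<^bsub>M\<^esub>} \<or> f ` carrier M = carrier M"
    if f: "f \<in> module_hom A M M" for f
  proof (cases "f ` carrier M = {\<zero>\<^bsub>M\<^esub>}")
    case False
    interpret M: right_module A M by (rule mod_cat_right_module[OF M])
    interpret G: abelian_group M by (rule M.abelian_group)
    let ?f = "restrict f (carrier M)"
    have "?f \<in> carrier (End_ring A M)"
      using f by (auto simp: End_ring_def module_hom_def M.act_closed)
    moreover have "?f \<noteq> \<zero>\<^bsub>End_ring A M\<^esub>"
    proof
      assume *: "?f = \<zero>\<^bsub>End_ring A M\<^esub>"
      have "f x = \<zero>\<^bsub>M\<^esub>" if "x \<in> carrier M" for x
        using fun_cong[OF *, of x] that by (simp add: End_ring_def)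
      hence "f ` carrier M = {\<zero>\<^bsub>M\<^esub>}" using G.zero_closed by force
      thus False using False by simp
    qed
    ultimately have "?f \<in> Units (End_ring A M)" using E.skew_field_Units by blast
    then obtain g where g: "g \<in> carrier (End_ring A M)"
        "?f \<otimes>\<^bsub>End_ring A M\<^esub> g = \<one>\<^bsub>End_ring A M\<^esub>"
      by (auto simp: Units_def)
    have gh: "g \<in> module_hom A M M" using g(1) by (simp add: End_ring_def)
    have "x \<in> f ` carrier M" if "x \<in> carrier M" for x
    proof -
      have "f (g x) = x"
        using fun_cong[OF g(2), of x] that hom_carrier[OF gh that]
        by (simp add: End_ring_def compose_def)
      thus ?thesis using hom_carrier[OF gh that] by (metis image_eqI)
    qed
    thus ?thesis using hom_carrier[OF f] by blast
  qed simp
  ultimately show ?rhs using M by blast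
next
  assume r: ?rhs
  hence M: "M \<in> mod_cat K A" by simp
  interpret M: right_module A M by (rule mod_cat_right_module[OF M])
  interpret G: abelian_group M by (rule M.abelian_group)
  interpret E: ring "End_ring A M" by (rule End_ring_ring[OF M])
  have nz: "\<one>\<^bsub>End_ring A M\<^esub> \<noteq> \<zero>\<^bsub>End_ring A M\<^esub>"
  proof
    assume *: "\<one>\<^bsub>End_ring A M\<^esub> = \<zero>\<^bsub>End_ring A M\<^esub>"
    have "x = \<zero>\<^bsub>M\<^esub>" if "x \<in> carrier M" for x
      using fun_cong[OF *, of x] that by (simp add: End_ring_def)
    thus False using r G.zero_closed by blast
  qed
  have "Units (End_ring A M) = carrier (End_ring A M) - {\<zero>\<^bsub>End_ring A M\<^esub>}"
  proof (intro equalityI subsetI)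
    fix f assume f: "f \<in> Units (End_ring A M)"
    hence "f \<noteq> \<zero>\<^bsub>End_ring A M\<^esub>" using nz E.Units_r_inv_ex E.l_null by metis
    thus "f \<in> carrier (End_ring A M) - {\<zero>\<^bsub>End_ring A M\<^esub>}" using f by (simp add: Units_def)
  next
    fix f assume "f \<in> carrier (End_ring A M) - {\<zero>\<^bsub>End_ring A M\<^esub>}"
    hence fE: "f \<in> carrier (End_ring A M)" "f \<noteq> \<zero>\<^bsub>End_ring A M\<^esub>" by auto
    hence f: "f \<in> module_hom A M M" "f \<in> extensional (carrier M)" by (auto simp: End_ring_def)
    have "f ` carrier M \<noteq> {\<zero>\<^bsub>M\<^esub>}"
    proof
      assume *: "f ` carrier M = {\<zero>\<^bsub>M\<^esub>}"
      have "f = (\<lambda>x \<in> carrier M. \<zero>\<^bsub>M\<^esub>)"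
        by (rule extensionalityI[OF f(2)]) (use * in auto)
      thus False using fE(2) by (simp add: End_ring_def)
    qed
    hence surj: "f ` carrier M = carrier M" using r f(1) by blast
    have bij: "bij_betw f (carrier M) (carrier M)"
      unfolding bij_betw_def using surj dimension_surj(2)[OF M M f(1) surj] by simp
    let ?g = "restrict (inv_into (carrier M) f) (carrier M)"
    have g: "inv_into (carrier M) f \<in> module_hom A M M" by (rule hom_inverse[OF M f(1) bij])
    hence gE: "?g \<in> carrier (End_ring A M)"
      by (auto simp: End_ring_def module_hom_def M.act_closed)
    have "?g \<otimes>\<^bsub>End_ring A M\<^esub> f = \<one>\<^bsub>End_ring A M\<^esub>"
      using bij hom_carrier[OF f(1)]
      by (auto simp: End_ring_def compose_def bij_betw_def intro!: restrict_ext)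
    moreover have "f \<otimes>\<^bsub>End_ring A M\<^esub> ?g = \<one>\<^bsub>End_ring A M\<^esub>"
      using surj by (auto simp: End_ring_def compose_def f_inv_into_f intro!: restrict_ext)
    ultimately show "f \<in> Units (End_ring A M)" using fE(1) gE unfolding Units_def by blast
  qed
  hence "skew_field (End_ring A M)"
    using nz by (intro skew_field.intro skew_field_axioms.intro E.ring_axioms)
  thus "brick K A M" using M by (simp add: brick_def)
qed

lemma brick_endo:
  "brick K A M \<Longrightarrow> f \<in> module_hom A M M \<Longrightarrow> f ` carrier M = {\<zero>\<^bsub>M\<^esub>} \<or> f ` carrier M = carrier M"
  by (simp add: brick_iff)

text \<open>A module \<open>M\<close> of minimal dimension in \<open>T' - T\<close> works. A nonzero
  image in \<open>M\<close> of an object of \<open>T\<close> would be the kernel of a surjection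
  onto a smaller module, which lies in \<open>T\<close> by minimality; then \<open>M\<close> would
  be an extension of objects of \<open>T\<close>. It follows that \<open>M\<close> is a brick: the
  image of an endomorphism that is not onto lies in \<open>T\<close> by minimality, so its inclusion
  into \<open>M\<close> is zero.\<close>

lemma brick_between:
  assumes T: "torsion_class K A T" and T': "torsion_class K A T'" and "\<not> T' \<subseteq> T"
  shows "\<exists>B. brick K A B \<and> B \<in> T' \<and> B \<notin> T \<and> (\<forall>L\<in>T. hom_zero A L B)"
proof -
  obtain M where M: "M \<in> T' - T" and min: "\<And>N. N \<in> T' - T \<Longrightarrow> dimension M \<le> dimension N"
    using ex_has_least_nat[of "\<lambda>M. M \<in> T' - T" _ dimension] assms(3) by blast
  have MA: "M \<in> mod_cat K A" using torsion_mod_cat[OF T'] M by blast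
  have perp: "hom_zero A L M" if L: "L \<in> T" for L
    unfolding hom_zero_iff_image[OF torsion_mod_cat[OF T L] MA]
  proof (intro ballI, rule ccontr)
    fix f assume f: "f \<in> module_hom A L M" and nz: "f ` carrier L \<noteq> {\<zero>\<^bsub>M\<^esub>}"
    let ?Y = "f ` carrier L"
    have Y: "is_submodule ?Y M" by (rule hom_image_submodule[OF torsion_mod_cat[OF T L] MA f])
    obtain N g where N: "N \<in> mod_cat K A" "g \<in> module_hom A M N" "g ` carrier M = carrier N"
        "{x \<in> carrier M. g x = \<zero>\<^bsub>N\<^esub>} = ?Y"
      using quotient_exists[OF MA Y] by blast
    have "\<not> inj_on g (carrier M)"
    proof
      assume i: "inj_on g (carrier M)"
      have "x = \<zero>\<^bsub>M\<^esub>" if "x \<in> ?Y" for x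
      proof (rule inj_onD[OF i])
        show "g x = g \<zero>\<^bsub>M\<^esub>" "x \<in> carrier M"
          using that N(4) hom_zero_map[OF MA N(1,2)] by auto
      qed (simp add: MA)
      moreover have "\<zero>\<^bsub>M\<^esub> \<in> ?Y" using Y by (simp add: is_submodule_def)
      ultimately show False using nz by blast
    qed
    hence "dimension N < dimension M" using dimension_surj[OF MA N(1-3)] by linarith
    moreover have "N \<in> T'" using torsion_quotient[OF T' _ N(1-3)] M by blast
    ultimately have "N \<in> T" using min[of N] by fastforce
    moreover have "M\<lparr>carrier := ?Y\<rparr> \<in> T" by (rule torsion_image[OF T L MA f])
    moreover have "short_exact A (M\<lparr>carrier := ?Y\<rparr>) M N"
      by (rule short_exact_submodule) (use N Y in \<open>auto simp: is_submodule_def\<close>)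
    ultimately have "M \<in> T" using torsion_extension[OF T _ _ MA] by blast
    thus False using M by blast
  qed
  have "f ` carrier M = {\<zero>\<^bsub>M\<^esub>} \<or> f ` carrier M = carrier M" if f: "f \<in> module_hom A M M" for f
  proof (cases "f ` carrier M = carrier M")
    case False
    let ?Y = "f ` carrier M"
    have Y: "is_submodule ?Y M" by (rule hom_image_submodule[OF MA MA f])
    have "dimension (M\<lparr>carrier := ?Y\<rparr>) < dimension M"
      using submodule_mod_cat[OF MA Y] False by linarith
    moreover have "M\<lparr>carrier := ?Y\<rparr> \<in> T'" by (rule torsion_image[OF T' _ MA f]) (use M in blast)
    ultimately have "M\<lparr>carrier := ?Y\<rparr> \<in> T" using min[of "M\<lparr>carrier := ?Y\<rparr>"] by fastforce
    moreover have "(\<lambda>x. x) \<in> module_hom A (M\<lparr>carrier := ?Y\<rparr>) M"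
      using submodule_incl_hom[of ?Y M] Y by (simp add: is_submodule_def)
    ultimately have "\<forall>x\<in>?Y. x = \<zero>\<^bsub>M\<^esub>"
      using perp[of "M\<lparr>carrier := ?Y\<rparr>"] unfolding hom_zero_def by auto
    thus ?thesis using Y by (auto simp: is_submodule_def)
  qed simp
  moreover have "carrier M \<noteq> {\<zero>\<^bsub>M\<^esub>}" using torsion_zero[OF T MA] M by blast
  ultimately have "brick K A M" using MA by (simp add: brick_iff)
  thus ?thesis using M perp by blast
qed

lemma module_iso_refl: "module_iso A M M"
  unfolding module_iso_def by (intro bexI[of _ "\<lambda>x. x"] hom_id) (simp add: bij_betw_def)

lemma module_iso_brick:
  assumes B: "brick K A B" and N: "N \<in> mod_cat K A" and iso: "module_iso A B N"
  shows "brick K A N"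
proof -
  have BA: "B \<in> mod_cat K A" using B by (simp add: brick_def)
  obtain f where f: "f \<in> module_hom A B N" "bij_betw f (carrier B) (carrier N)"
    using iso by (auto simp: module_iso_def)
  let ?g = "inv_into (carrier B) f"
  have g: "?g \<in> module_hom A N B" by (rule hom_inverse[OF BA f])
  have fs: "f ` carrier B = carrier N" and gs: "?g ` carrier N = carrier B"
    using f(2) bij_betw_inv_into[OF f(2)] by (auto simp: bij_betw_def)
  have f0: "f \<zero>\<^bsub>B\<^esub> = \<zero>\<^bsub>N\<^esub>" by (rule hom_zero_map[OF BA N f(1)])
  have "h ` carrier N = {\<zero>\<^bsub>N\<^esub>} \<or> h ` carrier N = carrier N" if h: "h \<in> module_hom A N N" for h
  proof -
    \<comment> \<open>The endomorphism \<open>h\<close> of \<open>N\<close> is conjugated to one of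
      \<open>B\<close>, to which \<open>brick_endo\<close> applies.\<close>
    let ?e = "\<lambda>x. ?g (h (f x))"
    have e: "?e \<in> module_hom A B B" by (rule hom_comp[OF hom_comp[OF f(1) h] g])
    have "f (?e x) = h (f x)" if "x \<in> carrier B" for x
      using that hom_carrier[OF f(1) that] hom_carrier[OF h] fs by (simp add: f_inv_into_f)
    hence "h ` f ` carrier B = f ` ?e ` carrier B" by (simp add: image_image)
    hence eq: "h ` carrier N = f ` ?e ` carrier B" by (simp only: fs)
    have "?e ` carrier B = {\<zero>\<^bsub>B\<^esub>} \<or> ?e ` carrier B = carrier B"
      by (rule brick_endo[OF B e])
    thus ?thesis
    proof
      assume "?e ` carrier B = {\<zero>\<^bsub>B\<^esub>}"
      thus ?thesis unfolding eq using f0 by simp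
    next
      assume "?e ` carrier B = carrier B"
      thus ?thesis unfolding eq using fs by simp
    qed
  qed
  moreover have "carrier N \<noteq> {\<zero>\<^bsub>N\<^esub>}"
  proof
    assume "carrier N = {\<zero>\<^bsub>N\<^esub>}"
    hence "\<exists>b. carrier B = {b}" using gs by (metis image_empty image_insert)
    hence "carrier B = {\<zero>\<^bsub>B\<^esub>}" using mod_cat_zero_closed[OF BA] by (metis singletonD)
    thus False using B by (simp add: brick_iff)
  qed
  ultimately show ?thesis using N by (simp add: brick_iff)
qed

lemma hom_zero_iso:
  assumes "B \<in> mod_cat K A" "N \<in> mod_cat K A" "module_iso A B N" "hom_zero A L B"
  shows "hom_zero A L N"
  unfolding hom_zero_def
proof (intro ballI)
  fix h x assume h: "h \<in> module_hom A L N" and x: "x \<in> carrier L"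
  obtain f where f: "f \<in> module_hom A B N" "bij_betw f (carrier B) (carrier N)"
    using assms(3) by (auto simp: module_iso_def)
  let ?g = "inv_into (carrier B) f"
  have "?g (h x) = \<zero>\<^bsub>B\<^esub>"
    by (rule hom_zeroD[OF assms(4) hom_comp[OF h hom_inverse[OF assms(1) f]] x])
  moreover have "f (?g (h x)) = h x"
    using f(2) hom_carrier[OF h x] by (simp add: bij_betw_def f_inv_into_f)
  ultimately show "h x = \<zero>\<^bsub>N\<^esub>" using hom_zero_map[OF assms(1,2) f(1)] by simp
qed

lemma torsion_iso:
  assumes "torsion_class K A T" "B \<in> T" "N \<in> mod_cat K A" "module_iso A B N"
  shows "N \<in> T"
proof -
  obtain f where "f \<in> module_hom A B N" "f ` carrier B = carrier N"
    using assms(4) by (auto simp: module_iso_def bij_betw_def)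
  thus ?thesis by (rule torsion_quotient[OF assms(1-3)])
qed


lemma brick_mod_cat: "brick K A M \<Longrightarrow> M \<in> mod_cat K A"
  by (simp add: brick_def)

lemma brick_nonzero: "brick K A M \<Longrightarrow> carrier M \<noteq> {\<zero>\<^bsub>M\<^esub>}"
  by (simp add: brick_iff)

lemma not_hom_zero_self:
  assumes "M \<in> mod_cat K A" "carrier M \<noteq> {\<zero>\<^bsub>M\<^esub>}"
  shows "\<not> hom_zero A M M"
proof
  assume *: "hom_zero A M M"
  have "x = \<zero>\<^bsub>M\<^esub>" if "x \<in> carrier M" for x by (rule hom_zeroD[OF * hom_id that])
  thus False using assms mod_cat_zero_closed[OF assms(1)] by blast
qed

text \<open>For a brick \<open>S\<close> this torsion class contains \<open>S\<close> and all
  modules without nonzero maps to \<open>S\<close>. Whatever such modules generate therefore maps to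
  \<open>S\<close> either by zero or onto.\<close>

definition zero_or_onto :: "('a, 'k list) module \<Rightarrow> ('a, 'k list) module set" where
  "zero_or_onto S = {X \<in> mod_cat K A. \<forall>h \<in> module_hom A X S.
    h ` carrier X = {\<zero>\<^bsub>S\<^esub>} \<or> h ` carrier X = carrier S}"

lemma torsion_class_zero_or_onto: "S \<in> mod_cat K A \<Longrightarrow> torsion_class K A (zero_or_onto S)"
  using torsion_class_image_cond[of S True] by (simp add: zero_or_onto_def)

lemma zero_or_ontoD:
  assumes "X \<in> zero_or_onto S" "h \<in> module_hom A X S" "h ` carrier X \<noteq> {\<zero>\<^bsub>S\<^esub>}"
  shows "h ` carrier X = carrier S"
proof -
  have "\<forall>h \<in> module_hom A X S. h ` carrier X = {\<zero>\<^bsub>S\<^esub>} \<or> h ` carrier X = carrier S"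
    using assms(1) by (simp add: zero_or_onto_def)
  from bspec[OF this assms(2)] show ?thesis using assms(3) by simp
qed

lemma hom_zero_zero_or_onto:
  "X \<in> mod_cat K A \<Longrightarrow> S \<in> mod_cat K A \<Longrightarrow> hom_zero A X S \<Longrightarrow> X \<in> zero_or_onto S"
  by (simp add: zero_or_onto_def hom_zero_iff_image)

lemma brick_zero_or_onto: "brick K A S \<Longrightarrow> S \<in> zero_or_onto S"
  using brick_endo brick_mod_cat by (simp add: zero_or_onto_def)

text \<open>Take \<open>Y\<close> of largest dimension among the submodules of \<open>M\<close> that
  lie in \<open>X\<close>. For another such \<open>Z\<close>, the sum of \<open>Y\<close> and
  \<open>Z\<close> is an extension of a quotient of \<open>Z\<close> by \<open>Y\<close>, hence in
  \<open>X\<close>, and maximality makes it equal to \<open>Y\<close>.\<close>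

lemma trace_exists:
  assumes X: "torsion_class K A X" and M: "M \<in> mod_cat K A"
  shows "\<exists>Y. is_submodule Y M \<and> M\<lparr>carrier := Y\<rparr> \<in> X \<and>
    (\<forall>Z. is_submodule Z M \<longrightarrow> M\<lparr>carrier := Z\<rparr> \<in> X \<longrightarrow> Z \<subseteq> Y)"
proof -
  interpret M: right_module A M by (rule mod_cat_right_module[OF M])
  interpret G: abelian_group M by (rule M.abelian_group)
  let ?P = "\<lambda>Y. is_submodule Y M \<and> M\<lparr>carrier := Y\<rparr> \<in> X"
  have z: "is_submodule {\<zero>\<^bsub>M\<^esub>} M" by (simp add: is_submodule_def M.act_zero)
  have "?P {\<zero>\<^bsub>M\<^esub>}"
    using z torsion_zero[OF X submodule_mod_cat(1)[OF M z]] by simp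
  then obtain Y where Y: "?P Y"
    and max: "\<And>Z. ?P Z \<Longrightarrow> dimension (M\<lparr>carrier := Z\<rparr>) \<le> dimension (M\<lparr>carrier := Y\<rparr>)"
    using ex_has_greatest_nat[of ?P "{\<zero>\<^bsub>M\<^esub>}" "\<lambda>Y. dimension (M\<lparr>carrier := Y\<rparr>)" "Suc (dimension M)"]
      submodule_mod_cat(2)[OF M] by (metis less_Suc_eq_le)
  have "Z \<subseteq> Y" if Z: "?P Z" for Z
  proof -
    let ?S = "{y \<oplus>\<^bsub>M\<^esub> z |y z. y \<in> Y \<and> z \<in> Z}"
    let ?M = "M\<lparr>carrier := ?S\<rparr>"
    have Ys: "Y \<subseteq> carrier M" "\<zero>\<^bsub>M\<^esub> \<in> Y" "\<And>x y. x \<in> Y \<Longrightarrow> y \<in> Y \<Longrightarrow> x \<oplus>\<^bsub>M\<^esub> y \<in> Y"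
      "\<And>a x. a \<in> carrier A \<Longrightarrow> x \<in> Y \<Longrightarrow> a \<odot>\<^bsub>M\<^esub> x \<in> Y"
      using Y by (auto simp: is_submodule_def)
    have Zs: "Z \<subseteq> carrier M" "\<zero>\<^bsub>M\<^esub> \<in> Z" "\<And>x y. x \<in> Z \<Longrightarrow> y \<in> Z \<Longrightarrow> x \<oplus>\<^bsub>M\<^esub> y \<in> Z"
      "\<And>a x. a \<in> carrier A \<Longrightarrow> x \<in> Z \<Longrightarrow> a \<odot>\<^bsub>M\<^esub> x \<in> Z"
      using Z by (auto simp: is_submodule_def)
    have YS: "Y \<subseteq> ?S"
    proof
      fix y assume "y \<in> Y"
      moreover have "y = y \<oplus>\<^bsub>M\<^esub> \<zero>\<^bsub>M\<^esub>" using \<open>y \<in> Y\<close> Ys(1) by auto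
      ultimately show "y \<in> ?S" using Zs(2) by blast
    qed
    have ZS: "Z \<subseteq> ?S"
    proof
      fix z assume "z \<in> Z"
      moreover have "z = \<zero>\<^bsub>M\<^esub> \<oplus>\<^bsub>M\<^esub> z" using \<open>z \<in> Z\<close> Zs(1) by auto
      ultimately show "z \<in> ?S" using Ys(2) by blast
    qed
    have S: "is_submodule ?S M"
      unfolding is_submodule_def
    proof (intro conjI ballI)
      show "?S \<subseteq> carrier M" using Ys(1) Zs(1) by auto
      show "\<zero>\<^bsub>M\<^esub> \<in> ?S" using YS Ys(2) by blast
    next
      fix u v assume "u \<in> ?S" "v \<in> ?S"
      then obtain y z y' z' where e: "u = y \<oplus>\<^bsub>M\<^esub> z" "v = y' \<oplus>\<^bsub>M\<^esub> z'"
          "y \<in> Y" "z \<in> Z" "y' \<in> Y" "z' \<in> Z" by blast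
      have "y \<in> carrier M" "z \<in> carrier M" "y' \<in> carrier M" "z' \<in> carrier M"
        using e Ys(1) Zs(1) by auto
      hence "u \<oplus>\<^bsub>M\<^esub> v = (y \<oplus>\<^bsub>M\<^esub> y') \<oplus>\<^bsub>M\<^esub> (z \<oplus>\<^bsub>M\<^esub> z')"
        unfolding e by (simp add: G.a_ac)
      thus "u \<oplus>\<^bsub>M\<^esub> v \<in> ?S" using Ys(3)[OF e(3,5)] Zs(3)[OF e(4,6)] by blast
    next
      fix a u assume a: "a \<in> carrier A" and "u \<in> ?S"
      then obtain y z where e: "u = y \<oplus>\<^bsub>M\<^esub> z" "y \<in> Y" "z \<in> Z" by blast
      have "y \<in> carrier M" "z \<in> carrier M" using e Ys(1) Zs(1) by auto
      hence "a \<odot>\<^bsub>M\<^esub> u = a \<odot>\<^bsub>M\<^esub> y \<oplus>\<^bsub>M\<^esub> a \<odot>\<^bsub>M\<^esub> z"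
        unfolding e by (simp add: M.act_add[OF a])
      thus "a \<odot>\<^bsub>M\<^esub> u \<in> ?S" using Ys(4)[OF a e(2)] Zs(4)[OF a e(3)] by blast
    qed
    have MS: "?M \<in> mod_cat K A" by (rule submodule_mod_cat(1)[OF M S])
    have YM: "is_submodule Y ?M" using YS Ys by (simp add: is_submodule_def)
    obtain N g where N: "N \<in> mod_cat K A" and g: "g \<in> module_hom A ?M N"
      "g ` carrier ?M = carrier N" "{x \<in> carrier ?M. g x = \<zero>\<^bsub>N\<^esub>} = Y"
      using quotient_exists[OF MS YM] by blast
    interpret N: abelian_group N by (rule mod_cat_abelian_group[OF N])
    have gZ: "g \<in> module_hom A (M\<lparr>carrier := Z\<rparr>) N"
      using hom_comp[OF submodule_incl_hom[of Z ?M] g(1)] ZS by simp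
    \<comment> \<open>Every class of the sum modulo \<open>Y\<close> is represented in
      \<open>Z\<close>, so the quotient \<open>N\<close> is an image of \<open>Z\<close> and lies in
      \<open>X\<close>.\<close>
    have "g ` Z = carrier N"
    proof
      show "g ` Z \<subseteq> carrier N" using hom_carrier[OF gZ] by auto
      show "carrier N \<subseteq> g ` Z"
      proof
        fix n assume "n \<in> carrier N"
        hence "n \<in> g ` ?S" using g(2) by simp
        then obtain y z where yz: "y \<in> Y" "z \<in> Z" "n = g (y \<oplus>\<^bsub>M\<^esub> z)" by blast
        have "g (y \<oplus>\<^bsub>M\<^esub> z) = g y \<oplus>\<^bsub>N\<^esub> g z"
          using module_hom_add[OF g(1), of y z] yz YS ZS by auto
        moreover have "g y = \<zero>\<^bsub>N\<^esub>" using g(3) yz(1) by blast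
        moreover have "g z \<in> carrier N" using hom_carrier[OF gZ] yz(2) by simp
        ultimately show "n \<in> g ` Z" using yz by simp
      qed
    qed
    hence NX: "N \<in> X" using torsion_quotient[OF X _ N gZ] Z by simp
    have YX: "?M\<lparr>carrier := Y\<rparr> \<in> X" using Y by simp
    have se: "short_exact A (?M\<lparr>carrier := Y\<rparr>) ?M N"
      by (rule short_exact_submodule[OF _ g]) (use YS in simp)
    have "?M \<in> X" by (rule torsion_extension[OF X YX NX MS se])
    hence "dimension ?M \<le> dimension (?M\<lparr>carrier := Y\<rparr>)" using max[of ?S] S by simp
    hence "Y = carrier ?M"
      by (intro submodule_mod_cat(3)[OF MS YM] le_antisym submodule_mod_cat(2)[OF MS YM])
    moreover have "carrier ?M = ?S" by simp
    ultimately have "Y = ?S" by (rule trans)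
    thus ?thesis by (rule subset_trans[OF ZS equalityD2])
  qed
  thus ?thesis using Y by blast
qed

end


section \<open>Jumps of maximal chains of torsion classes\<close>

definition jump :: "'c set set \<Rightarrow> 'c set \<Rightarrow> 'c set \<Rightarrow> bool" where
  "jump C U V \<longleftrightarrow> U \<in> C \<and> V \<in> C \<and> U \<subset> V \<and> (\<forall>X\<in>C. X \<subseteq> U \<or> V \<subseteq> X)"

context fin_dim_algebra
begin

section \<open>Membership in maximal chains\<close>

lemma maxchain_torsion_class: "subset.maxchain (tors K A) C \<Longrightarrow> X \<in> C \<Longrightarrow> torsion_class K A X"
  using subset.maxchain_imp_chain unfolding subset_chain_def tors_def by blast

lemma maxchain_total:
  "subset.maxchain (tors K A) C \<Longrightarrow> X \<in> C \<Longrightarrow> Y \<in> C \<Longrightarrow> X \<subseteq> Y \<or> Y \<subseteq> X"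
  using subset.maxchain_imp_chain unfolding subset_chain_def by blast

text \<open>Otherwise \<open>insert X C\<close> would be a longer chain.\<close>

lemma maxchain_mem:
  assumes C: "subset.maxchain (tors K A) C" and X: "torsion_class K A X"
    and cmp: "\<And>Y. Y \<in> C \<Longrightarrow> X \<subseteq> Y \<or> Y \<subseteq> X"
  shows "X \<in> C"
proof (rule ccontr)
  assume n: "X \<notin> C"
  have "subset.chain (tors K A) C" by (rule subset.maxchain_imp_chain[OF C])
  hence "subset.chain (tors K A) (insert X C)"
    using X cmp unfolding subset_chain_def tors_def by auto
  thus False using C n unfolding subset.maxchain_def by blast
qed

text \<open>Closure under extensions is the only condition that involves two members of the class;
  as \<open>D\<close> is totally ordered, both ends of the exact sequence lie in a single element of
  \<open>D\<close>.\<close>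

lemma torsion_class_Union_chain:
  assumes T: "\<And>X. X \<in> D \<Longrightarrow> torsion_class K A X" and ne: "D \<noteq> {}"
    and tot: "\<And>X Y. X \<in> D \<Longrightarrow> Y \<in> D \<Longrightarrow> X \<subseteq> Y \<or> Y \<subseteq> X"
  shows "torsion_class K A (\<Union>D)"
proof -
  have 1: "\<Union>D \<subseteq> mod_cat K A" using torsion_mod_cat T by blast
  have 2: "M \<in> \<Union>D" if "M \<in> mod_cat K A" "carrier M = {\<zero>\<^bsub>M\<^esub>}" for M
  proof -
    obtain X where "X \<in> D" using ne by blast
    thus ?thesis using torsion_zero[OF T that] by blast
  qed
  have 3: "N \<in> \<Union>D" if MD: "M \<in> \<Union>D" and MN: "N \<in> mod_cat K A" "f \<in> module_hom A M N"
    "f ` carrier M = carrier N" for M N f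
  proof -
    obtain X where X: "X \<in> D" "M \<in> X" using MD by blast
    have "N \<in> X" by (rule torsion_quotient[OF T[OF X(1)] X(2) MN])
    thus ?thesis using X(1) by blast
  qed
  have 4: "M \<in> \<Union>D" if LN: "L \<in> \<Union>D" "N \<in> \<Union>D" and M: "M \<in> mod_cat K A" "short_exact A L M N" for L M N
  proof -
    obtain X Y where XY: "X \<in> D" "L \<in> X" "Y \<in> D" "N \<in> Y" using LN by blast
    obtain Z where Z: "Z \<in> D" "L \<in> Z" "N \<in> Z" using tot[OF XY(1,3)] XY by blast
    have "M \<in> Z" by (rule torsion_extension[OF T[OF Z(1)] Z(2,3) M])
    thus ?thesis using Z(1) by blast
  qed
  show ?thesis unfolding torsion_class_def
    by (intro conjI ballI impI) (rule 1, erule (1) 2, elim bexE, erule (3) 3, erule (3) 4)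
qed

lemma maxchain_Union:
  assumes C: "subset.maxchain (tors K A) C" and D: "D \<subseteq> C" "D \<noteq> {}"
  shows "\<Union>D \<in> C"
proof (rule maxchain_mem[OF C])
  show "torsion_class K A (\<Union>D)"
    using torsion_class_Union_chain[OF _ D(2)] maxchain_torsion_class[OF C]
      maxchain_total[OF C] D(1) by (meson subsetD)
  show "\<Union>D \<subseteq> Y \<or> Y \<subseteq> \<Union>D" if "Y \<in> C" for Y
    using maxchain_total[OF C that] D(1) by blast
qed

lemma maxchain_Inter:
  assumes C: "subset.maxchain (tors K A) C" and D: "D \<subseteq> C" "D \<noteq> {}"
  shows "\<Inter>D \<in> C"
proof (rule maxchain_mem[OF C])
  show "torsion_class K A (\<Inter>D)"
    by (rule torsion_class_Inter[OF _ D(2)]) (use maxchain_torsion_class[OF C] D(1) in blast)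
  show "\<Inter>D \<subseteq> Y \<or> Y \<subseteq> \<Inter>D" if "Y \<in> C" for Y
    using maxchain_total[OF C that] D(1) by blast
qed

text \<open>\<open>W \<inter> V\<close> lies between \<open>U\<close> and \<open>V\<close>, so it is
  comparable with every member of \<open>C\<close> and belongs to \<open>C\<close>. Because of
  \<open>B\<close> it is not contained in \<open>U\<close>, so it contains \<open>V\<close>.\<close>

lemma jump_generate:
  assumes C: "subset.maxchain (tors K A) C" and j: "jump C U V"
    and W: "torsion_class K A W" "U \<subseteq> W" and B: "B \<in> V" "B \<notin> U" "B \<in> W"
  shows "V \<subseteq> W"
proof -
  have V: "torsion_class K A V" using maxchain_torsion_class[OF C] j by (simp add: jump_def)
  have "torsion_class K A (W \<inter> V)"
    using torsion_class_Inter[of "{W, V}" K A] W(1) V by auto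
  hence "W \<inter> V \<in> C"
  proof (rule maxchain_mem[OF C])
    fix Y assume "Y \<in> C"
    hence "Y \<subseteq> U \<or> V \<subseteq> Y" using j by (simp add: jump_def)
    thus "W \<inter> V \<subseteq> Y \<or> Y \<subseteq> W \<inter> V" using W(2) j by (auto simp: jump_def)
  qed
  moreover have "\<forall>X\<in>C. X \<subseteq> U \<or> V \<subseteq> X" using j by (simp add: jump_def)
  ultimately have "W \<inter> V \<subseteq> U \<or> V \<subseteq> W \<inter> V" by (rule bspec[rotated])
  thus ?thesis using B by blast
qed

text \<open>This is \<open>jump_generate\<close> for the torsion class of modules without nonzero
  maps to \<open>Y\<close>: if \<open>B\<close> belonged to it, so would all of \<open>V\<close>.
  Thus a single witness \<open>X\<close> forces every object of \<open>V - U\<close> to map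
  nontrivially to \<open>Y\<close>.\<close>

lemma jump_hom_nonzero:
  assumes C: "subset.maxchain (tors K A) C" and j: "jump C U V"
    and B: "B \<in> V" "B \<notin> U" and Y: "Y \<in> mod_cat K A" "\<And>L. L \<in> U \<Longrightarrow> hom_zero A L Y"
    and X: "X \<in> V" "\<not> hom_zero A X Y"
  shows "\<not> hom_zero A B Y"
proof
  assume h: "hom_zero A B Y"
  have UV: "U \<in> C" "V \<in> C" using j by (auto simp: jump_def)
  have "V \<subseteq> {X \<in> mod_cat K A. hom_zero A X Y}"
  proof (rule jump_generate[OF C j torsion_class_hom_zero[OF Y(1)] _ B])
    show "U \<subseteq> {X \<in> mod_cat K A. hom_zero A X Y}"
      using Y(2) torsion_mod_cat[OF maxchain_torsion_class[OF C UV(1)]] by blast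
    show "B \<in> {X \<in> mod_cat K A. hom_zero A X Y}"
      using h torsion_mod_cat[OF maxchain_torsion_class[OF C UV(2)] B(1)] by blast
  qed
  thus False using X by blast
qed

text \<open>The lower end of the jump is not an argument, since \<open>V\<close> determines it as
  the largest member of \<open>C\<close> strictly below \<open>V\<close>. The label is thus a
  function of the upper end, as the index map of a chain of bricks has to be; its value at a jump is
  a full isomorphism class by \<open>label_iso_class\<close>.\<close>

definition label :: "('a, 'k list) module set set \<Rightarrow> ('a, 'k list) module set
    \<Rightarrow> ('a, 'k list) module set" where
  "label C V = {M. brick K A M \<and> M \<in> V \<and> (\<forall>X\<in>C. X \<subset> V \<longrightarrow> (\<forall>L\<in>X. hom_zero A L M))}"

lemma label_iff:
  assumes j: "jump C U V"
  shows "M \<in> label C V \<longleftrightarrow> brick K A M \<and> M \<in> V \<and> (\<forall>L\<in>U. hom_zero A L M)"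
proof -
  have "(\<forall>X\<in>C. X \<subset> V \<longrightarrow> (\<forall>L\<in>X. hom_zero A L M)) \<longleftrightarrow> (\<forall>L\<in>U. hom_zero A L M)"
  proof
    show "\<forall>L\<in>U. hom_zero A L M" if "\<forall>X\<in>C. X \<subset> V \<longrightarrow> (\<forall>L\<in>X. hom_zero A L M)"
      using that j unfolding jump_def by blast
    show "\<forall>X\<in>C. X \<subset> V \<longrightarrow> (\<forall>L\<in>X. hom_zero A L M)" if *: "\<forall>L\<in>U. hom_zero A L M"
    proof (intro ballI impI)
      fix X L assume "X \<in> C" "X \<subset> V" "L \<in> X"
      hence "L \<in> U" using j by (auto simp: jump_def)
      thus "hom_zero A L M" using * by blast
    qed
  qed
  thus ?thesis by (simp add: label_def)
qed

lemma label_brick: "M \<in> label C V \<Longrightarrow> brick K A M"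
  by (simp add: label_def)

lemma label_not_below:
  assumes "jump C U V" "M \<in> label C V"
  shows "M \<notin> U"
  using assms brick_not_hom_zero label_iff[OF assms(1)] by blast

lemma label_nonempty:
  assumes C: "subset.maxchain (tors K A) C" and j: "jump C U V"
  shows "\<exists>B. B \<in> label C V"
proof -
  have "torsion_class K A U" "torsion_class K A V" "\<not> V \<subseteq> U"
    using j maxchain_torsion_class[OF C] by (auto simp: jump_def)
  from brick_between[OF this] show ?thesis unfolding label_iff[OF j] by blast
qed

text \<open>Any two such bricks \<open>P\<close> and \<open>Q\<close> map onto each other: a nonzero
  map exists by \<open>jump_hom_nonzero\<close>, and it is onto because \<open>jump_generate\<close>
  places \<open>V\<close> inside \<open>zero_or_onto Q\<close>. Equal dimensions then make a
  surjection bijective.\<close>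

lemma label_iso:
  assumes C: "subset.maxchain (tors K A) C" and j: "jump C U V"
    and M: "M \<in> label C V" and N: "N \<in> label C V"
  shows "module_iso A M N"
proof -
  have V: "torsion_class K A V" and U: "torsion_class K A U"
    using j maxchain_torsion_class[OF C] by (auto simp: jump_def)
  have surj: "\<exists>f \<in> module_hom A P Q. f ` carrier P = carrier Q"
    if P: "P \<in> label C V" and Q: "Q \<in> label C V" for P Q
  proof -
    have PA: "P \<in> mod_cat K A" and QA: "Q \<in> mod_cat K A"
      using P Q label_brick brick_mod_cat by blast+
    have "\<not> hom_zero A P Q"
    proof (rule jump_hom_nonzero[OF C j _ label_not_below[OF j P] QA])
      show "\<not> hom_zero A Q Q" using Q label_brick brick_not_hom_zero by blast
    qed (use P Q in \<open>auto simp: label_iff[OF j]\<close>)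
    then obtain f where f: "f \<in> module_hom A P Q" "f ` carrier P \<noteq> {\<zero>\<^bsub>Q\<^esub>}"
      using hom_zero_iff_image[OF PA QA] by blast
    have "V \<subseteq> zero_or_onto Q"
    proof (rule jump_generate[OF C j torsion_class_zero_or_onto[OF QA]])
      show "U \<subseteq> zero_or_onto Q"
        using hom_zero_zero_or_onto[OF torsion_mod_cat[OF U] QA] Q by (auto simp: label_iff[OF j])
      show "Q \<in> zero_or_onto Q" by (rule brick_zero_or_onto[OF label_brick[OF Q]])
    qed (use Q label_not_below[OF j Q] in \<open>auto simp: label_iff[OF j]\<close>)
    moreover have "P \<in> V" using P by (simp add: label_def)
    ultimately have "f ` carrier P = carrier Q" using zero_or_ontoD f by blast
    thus ?thesis using f(1) by blast
  qed
  have MA: "M \<in> mod_cat K A" and NA: "N \<in> mod_cat K A"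
    using M N label_brick brick_mod_cat by blast+
  obtain f where f: "f \<in> module_hom A M N" "f ` carrier M = carrier N" using surj[OF M N] by blast
  obtain g where g: "g \<in> module_hom A N M" "g ` carrier N = carrier M" using surj[OF N M] by blast
  have "dimension N = dimension M"
    using dimension_surj(1)[OF MA NA f] dimension_surj(1)[OF NA MA g] by simp
  hence "inj_on f (carrier M)" by (rule dimension_surj(2)[OF MA NA f])
  thus ?thesis using f unfolding module_iso_def bij_betw_def by blast
qed

lemma label_iso_class:
  assumes C: "subset.maxchain (tors K A) C" and j: "jump C U V" and B: "B \<in> label C V"
  shows "label C V = iso_class K A B"
proof (intro equalityI subsetI)
  fix N assume N: "N \<in> label C V"
  thus "N \<in> iso_class K A B"
    using label_iso[OF C j B N] brick_mod_cat[OF label_brick[OF N]] by (simp add: iso_class_def)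
next
  fix N assume "N \<in> iso_class K A B"
  hence N: "N \<in> mod_cat K A" "module_iso A B N" by (auto simp: iso_class_def)
  have Bb: "brick K A B" by (rule label_brick[OF B])
  have V: "torsion_class K A V"
    using j maxchain_torsion_class[OF C] by (auto simp: jump_def)
  have "N \<in> V" using torsion_iso[OF V _ N] B by (simp add: label_def)
  moreover have "hom_zero A L N" if "L \<in> U" for L
  proof (rule hom_zero_iso[OF brick_mod_cat[OF Bb] N])
    show "hom_zero A L B" using B that unfolding label_iff[OF j] by blast
  qed
  ultimately show "N \<in> label C V"
    using module_iso_brick[OF Bb N] by (simp add: label_iff[OF j])
qed

text \<open>As \<open>P\<close> passes to smaller members, it cuts \<open>C\<close> into a lower and
  an upper part; \<open>X\<close> and \<open>Y\<close> show that both are nonempty. When the union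
  of the lower part still satisfies \<open>P\<close> and the intersection of the upper part still
  violates it, the two are neighbours in \<open>C\<close>.\<close>

lemma cut_jump:
  assumes C: "subset.maxchain (tors K A) C"
    and X: "X \<in> C" "P X" and Y: "Y \<in> C" "\<not> P Y"
    and down: "\<And>X Y. X \<in> C \<Longrightarrow> Y \<in> C \<Longrightarrow> X \<subseteq> Y \<Longrightarrow> P Y \<Longrightarrow> P X"
    and U: "P (\<Union>{X \<in> C. P X})" and V: "\<not> P (\<Inter>{X \<in> C. \<not> P X})"
  shows "jump C (\<Union>{X \<in> C. P X}) (\<Inter>{X \<in> C. \<not> P X})"
proof -
  have UC: "\<Union>{X \<in> C. P X} \<in> C" by (rule maxchain_Union[OF C]) (use X in auto)
  have VC: "\<Inter>{X \<in> C. \<not> P X} \<in> C" by (rule maxchain_Inter[OF C]) (use Y in auto)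
  have n: "\<not> \<Inter>{X \<in> C. \<not> P X} \<subseteq> \<Union>{X \<in> C. P X}"
    using V down[OF VC UC _ U] by (rule contrapos_nn)
  have "Y \<subset> Z" if "\<not> Z \<subseteq> Y" "Y \<subseteq> Z \<or> Z \<subseteq> Y" for Y Z :: "('a, 'k list) module set"
    using that by blast
  from this[OF n maxchain_total[OF C UC VC]]
  have "\<Union>{X \<in> C. P X} \<subset> \<Inter>{X \<in> C. \<not> P X}" .
  thus ?thesis unfolding jump_def using UC VC by blast
qed

text \<open>Together with \<open>mod_cat_maxchain\<close> this supplies the two ends for
  \<open>cut_jump\<close>: the least and the greatest torsion class are comparable with all
  others.\<close>

lemma Inter_tors_maxchain:
  assumes C: "subset.maxchain (tors K A) C"
  shows "\<Inter>(tors K A) \<in> C"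
proof (rule maxchain_mem[OF C])
  have "tors K A \<noteq> {}" using torsion_class_mod_cat by (auto simp: tors_def)
  thus "torsion_class K A (\<Inter>(tors K A))"
    by (intro torsion_class_Inter) (simp_all add: tors_def)
  show "\<Inter>(tors K A) \<subseteq> Y \<or> Y \<subseteq> \<Inter>(tors K A)" if "Y \<in> C" for Y
    using maxchain_torsion_class[OF C that] unfolding tors_def by blast
qed

lemma mod_cat_maxchain:
  assumes C: "subset.maxchain (tors K A) C"
  shows "mod_cat K A \<in> C"
  using maxchain_mem[OF C torsion_class_mod_cat] maxchain_torsion_class[OF C] torsion_mod_cat
  by blast

text \<open>The class of modules without nonzero maps to \<open>M\<close> is itself a member of
  \<open>tors K A\<close>.\<close>

lemma Inter_tors_hom_zero:
  assumes "L \<in> \<Inter>(tors K A)" "M \<in> mod_cat K A"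
  shows "hom_zero A L M"
  using assms torsion_class_hom_zero[OF assms(2)] unfolding tors_def by blast

text \<open>The cut is made by non-membership of \<open>M\<close>. Unions preserve non-membership
  and intersections preserve membership, so \<open>cut_jump\<close> applies at once.\<close>

lemma enter_mem_jump:
  assumes C: "subset.maxchain (tors K A) C"
    and M: "M \<in> mod_cat K A" "carrier M \<noteq> {\<zero>\<^bsub>M\<^esub>}"
  shows "\<exists>U V. jump C U V \<and> M \<in> V \<and> M \<notin> U"
proof -
  have "M \<notin> \<Inter>(tors K A)" using Inter_tors_hom_zero[OF _ M(1)] not_hom_zero_self[OF M] by blast
  hence "jump C (\<Union>{X \<in> C. M \<notin> X}) (\<Inter>{X \<in> C. \<not> M \<notin> X})"
    using Inter_tors_maxchain[OF C] mod_cat_maxchain[OF C] M(1)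
    by (intro cut_jump[OF C, where X="\<Inter>(tors K A)" and Y="mod_cat K A"]) auto
  moreover have "M \<notin> \<Union>{X \<in> C. M \<notin> X}" "M \<in> \<Inter>{X \<in> C. \<not> M \<notin> X}" by auto
  ultimately show ?thesis by blast
qed

text \<open>Here the cut is made by the vanishing of \<open>Hom(-, M)\<close>. Unions preserve it;
  that the intersection of the classes where it fails still maps nontrivially to \<open>M\<close> is
  the delicate point and rests on the finite dimension of \<open>M\<close>.\<close>

lemma enter_hom_jump:
  assumes C: "subset.maxchain (tors K A) C"
    and M: "M \<in> mod_cat K A" "carrier M \<noteq> {\<zero>\<^bsub>M\<^esub>}"
  shows "\<exists>U V. jump C U V \<and> (\<forall>L\<in>U. hom_zero A L M) \<and> (\<exists>L\<in>V. \<not> hom_zero A L M)"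
proof -
  let ?P = "\<lambda>X. \<forall>L\<in>X. hom_zero A L M"
  define tr where "tr X Y \<longleftrightarrow> is_submodule Y M \<and> M\<lparr>carrier := Y\<rparr> \<in> X \<and>
    (\<forall>Z. is_submodule Z M \<longrightarrow> M\<lparr>carrier := Z\<rparr> \<in> X \<longrightarrow> Z \<subseteq> Y)" for X Y
  \<comment> \<open>\<open>tr X Y\<close>: \<open>Y\<close> is the trace of \<open>X\<close> in \<open>M\<close>.  The nonzero traces form a chain of submodules; the
    smallest one lies in every \<open>X \<in> C\<close> with \<open>Hom(X, M) \<noteq> 0\<close>, hence in the intersection of these.\<close>
  define R where "R Y \<longleftrightarrow> (\<exists>X\<in>C. \<not> ?P X \<and> tr X Y)" for Y
  let ?d = "\<lambda>Y. dimension (M\<lparr>carrier := Y\<rparr>)"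
  have tr_ex: "\<exists>Y. tr X Y" if "X \<in> C" for X
    unfolding tr_def by (rule trace_exists[OF maxchain_torsion_class[OF C that] M(1)])
  have top: "mod_cat K A \<in> C" "\<not> ?P (mod_cat K A)"
    using mod_cat_maxchain[OF C] M(1) not_hom_zero_self[OF M] by blast+
  obtain Y1 where "tr (mod_cat K A) Y1" using tr_ex[OF top(1)] by blast
  hence "R Y1" using top R_def by blast
  then obtain Y where Y: "R Y" and min: "\<And>Z. R Z \<Longrightarrow> ?d Y \<le> ?d Z"
    using ex_has_least_nat[of R Y1 ?d] by blast
  obtain X0 where X0: "X0 \<in> C" "\<not> ?P X0" and trY: "tr X0 Y" using Y R_def by blast
  have Ysub: "is_submodule Y M" and YX0: "M\<lparr>carrier := Y\<rparr> \<in> X0"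
    and Ymax: "\<And>Z. is_submodule Z M \<Longrightarrow> M\<lparr>carrier := Z\<rparr> \<in> X0 \<Longrightarrow> Z \<subseteq> Y"
    using trY by (simp_all add: tr_def)
  have YA: "M\<lparr>carrier := Y\<rparr> \<in> mod_cat K A" by (rule submodule_mod_cat(1)[OF M(1) Ysub])
  have inV: "M\<lparr>carrier := Y\<rparr> \<in> X" if X: "X \<in> C" "\<not> ?P X" for X
  proof (cases "X0 \<subseteq> X")
    case True
    thus ?thesis using YX0 by blast
  next
    case False
    hence le: "X \<subseteq> X0" using maxchain_total[OF C X(1) X0(1)] by blast
    \<comment> \<open>For a smaller \<open>X\<close> the trace \<open>Z\<close> lies inside
      \<open>Y\<close>, and since \<open>Y\<close> has least dimension among the traces satisfying
      \<open>R\<close>, the two agree.\<close>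
    obtain Z where trZ: "tr X Z" using tr_ex[OF X(1)] by blast
    hence Z: "is_submodule Z M" "M\<lparr>carrier := Z\<rparr> \<in> X" by (simp_all add: tr_def)
    have ZY: "Z \<subseteq> Y" by (rule Ymax[OF Z(1)]) (use Z(2) le in blast)
    have "is_submodule Z (M\<lparr>carrier := Y\<rparr>)" using Z(1) ZY by (simp add: is_submodule_def)
    note sub = submodule_mod_cat[OF YA this]
    have "R Z" using X trZ R_def by blast
    hence "?d Y \<le> ?d Z" by (rule min)
    hence "Z = Y" using sub(2,3) by simp
    thus ?thesis using Z(2) by simp
  qed
  \<comment> \<open>Otherwise \<open>Y\<close> is zero; as \<open>Y\<close> contains every image in
    \<open>M\<close> of an object of \<open>X0\<close>, all maps from \<open>X0\<close> to
    \<open>M\<close> would vanish.\<close>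
  have nz: "\<not> hom_zero A (M\<lparr>carrier := Y\<rparr>) M"
  proof
    assume h: "hom_zero A (M\<lparr>carrier := Y\<rparr>) M"
    have YM: "Y \<subseteq> carrier M" using Ysub by (simp add: is_submodule_def)
    have zero: "y = \<zero>\<^bsub>M\<^esub>" if "y \<in> Y" for y
      using hom_zeroD[OF h submodule_incl_hom[OF YM]] that by simp
    have "hom_zero A L M" if L: "L \<in> X0" for L
      unfolding hom_zero_def
    proof (intro ballI)
      fix f x assume f: "f \<in> module_hom A L M" and x: "x \<in> carrier L"
      have X0t: "torsion_class K A X0" by (rule maxchain_torsion_class[OF C X0(1)])
      have "is_submodule (f ` carrier L) M"
        by (rule hom_image_submodule[OF torsion_mod_cat[OF X0t L] M(1) f])
      moreover have "M\<lparr>carrier := f ` carrier L\<rparr> \<in> X0" by (rule torsion_image[OF X0t L M(1) f])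
      ultimately have "f ` carrier L \<subseteq> Y" by (rule Ymax)
      thus "f x = \<zero>\<^bsub>M\<^esub>" using zero x by blast
    qed
    thus False using X0(2) by blast
  qed
  have mem: "M\<lparr>carrier := Y\<rparr> \<in> \<Inter>{X \<in> C. \<not> ?P X}" by (intro InterI inV) simp_all
  have V: "\<not> ?P (\<Inter>{X \<in> C. \<not> ?P X})"
  proof
    assume "?P (\<Inter>{X \<in> C. \<not> ?P X})"
    from bspec[OF this mem] show False using nz by simp
  qed
  have "jump C (\<Union>{X \<in> C. ?P X}) (\<Inter>{X \<in> C. \<not> ?P X})"
  proof (rule cut_jump[where P="?P", OF C Inter_tors_maxchain[OF C] _ top _ _ V])
    show "?P (\<Inter>(tors K A))" using Inter_tors_hom_zero[OF _ M(1)] by blast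
  qed blast+
  moreover have "?P (\<Union>{X \<in> C. ?P X})" by blast
  ultimately show ?thesis using V by blast
qed

end


section \<open>The chain of bricks of a maximal chain of torsion classes\<close>

lemma order_ideal_total:
  assumes r: "Linear_order r" and J: "order_ideal r J" "order_ideal r J'"
  shows "J \<subseteq> J' \<or> J' \<subseteq> J"
proof (rule ccontr)
  assume "\<not> ?thesis"
  then obtain i j where ij: "i \<in> J" "i \<notin> J'" "j \<in> J'" "j \<notin> J" by blast
  have "i \<in> Field r" "j \<in> Field r" using J ij by (auto simp: order_ideal_def)
  hence "(i, j) \<in> r \<or> (j, i) \<in> r"
    using r ij by (auto simp: linear_order_on_def total_on_def)
  thus False using J ij by (auto simp: order_ideal_def)
qed

text \<open>Both comparison maps preserve the values of the chains, and these values determine the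
  index, so the maps are mutually inverse. Hence \<open>f\<close> carries ideals to ideals, by
  monotonicity of \<open>g\<close>; a mere monotone injection need not do so.\<close>

lemma chain_le_Phi_subset:
  assumes inj: "inj_on S (Field r)" "inj_on S' (Field r')"
    and le: "chain_le (r, S) (r', S')" "chain_le (r', S') (r, S)"
  shows "Phi K A (r, S) \<subseteq> Phi K A (r', S')"
proof
  obtain f where f: "f \<in> Field r \<rightarrow> Field r'" "\<forall>i \<in> Field r. S i = S' (f i)"
    using le(1) by (auto simp: chain_le_def)
  obtain g where g: "g \<in> Field r' \<rightarrow> Field r" "\<forall>i \<in> Field r'. S' i = S (g i)"
    "\<forall>i j. (i, j) \<in> r' \<longrightarrow> (g i, g j) \<in> r"
    using le(2) by (auto simp: chain_le_def)
  have gf: "g (f i) = i" if "i \<in> Field r" for i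
  proof (rule inj_onD[OF inj(1)])
    show "S (g (f i)) = S i" using f g(2) that by (metis funcset_mem)
  qed (use f(1) g(1) that in auto)
  have fg: "f (g i) = i" if "i \<in> Field r'" for i
  proof (rule inj_onD[OF inj(2)])
    show "S' (f (g i)) = S' i" using f(2) g(1,2) that by (metis funcset_mem)
  qed (use f(1) g(1) that in auto)
  fix T assume "T \<in> Phi K A (r, S)"
  then obtain J where J: "order_ideal r J" "T = torsion_closure K A (\<Union>i\<in>J. S i)"
    by (auto simp: Phi_def)
  have JF: "J \<subseteq> Field r" using J(1) by (simp add: order_ideal_def)
  have "order_ideal r' (f ` J)"
    unfolding order_ideal_def
  proof (intro conjI ballI allI impI)
    show "f ` J \<subseteq> Field r'" using JF f(1) by auto
    fix j l assume "j \<in> f ` J" and l: "(l, j) \<in> r'"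
    then obtain i where i: "i \<in> J" "j = f i" by blast
    have "(g l, g (f i)) \<in> r" using g(3) l i(2) by blast
    hence "(g l, i) \<in> r" using gf i(1) JF by auto
    hence "g l \<in> J" using J(1) i(1) by (auto simp: order_ideal_def)
    moreover have "f (g l) = l" using fg l by (simp add: FieldI1)
    ultimately show "l \<in> f ` J" by (metis image_eqI)
  qed
  moreover have "(\<Union>i\<in>J. S i) = (\<Union>i\<in>f ` J. S' i)" using f(2) JF by auto
  ultimately show "T \<in> Phi K A (r', S')"
    unfolding Phi_def prod.case mem_Collect_eq using J(2) by (intro exI[of _ "f ` J"]) simp
qed

text \<open>A monotone bijection between total orders has a monotone inverse: a pair reversed by the
  inverse would be related both ways in \<open>r'\<close>.\<close>

lemma chain_le_surj_sym:
  assumes r: "Linear_order r" and r': "Linear_order r'"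
    and f: "f ` Field r = Field r'" "inj_on f (Field r)"
      "\<And>i j. (i, j) \<in> r \<Longrightarrow> (f i, f j) \<in> r'" "\<And>i. i \<in> Field r \<Longrightarrow> S i = S' (f i)"
  shows "chain_le (r', S') (r, S)"
proof -
  let ?g = "inv_into (Field r) f"
  have g: "?g x \<in> Field r" "f (?g x) = x" if "x \<in> Field r'" for x
    using that f(1) by (auto simp: inv_into_into f_inv_into_f)
  have mono: "(?g i, ?g j) \<in> r" if ij: "(i, j) \<in> r'" for i j
  proof (rule ccontr)
    assume n: "(?g i, ?g j) \<notin> r"
    have F: "i \<in> Field r'" "j \<in> Field r'" using ij by (auto simp: FieldI1 FieldI2)
    have refl: "(x, x) \<in> r" if "x \<in> Field r" for x
      using r that unfolding linear_order_on_def partial_order_on_def preorder_on_def refl_on_def by blast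
    hence "?g i \<noteq> ?g j" using n g F by metis
    hence "(?g j, ?g i) \<in> r"
      using n r g(1)[OF F(1)] g(1)[OF F(2)] unfolding linear_order_on_def total_on_def by blast
    hence "(j, i) \<in> r'" using f(3) g F by metis
    hence "i = j" using ij r' unfolding linear_order_on_def partial_order_on_def antisym_def by blast
    thus False using \<open>?g i \<noteq> ?g j\<close> by simp
  qed
  show ?thesis unfolding chain_le_def prod.case
  proof (rule bexI[of _ ?g], intro conjI allI impI ballI)
    show "inj_on ?g (Field r')" using f(1) by (metis inj_on_inv_into subset_refl)
    show "S' i = S (?g i)" if "i \<in> Field r'" for i using f(4) g[OF that] by simp
  qed (use mono g in auto)
qed

context fin_dim_algebra
begin


definition jump_tops :: "'c set set \<Rightarrow> 'c set set" where
  "jump_tops C = {V. \<exists>U. jump C U V}"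

text \<open>The chain written \<Psi>(C) in the overview. Indexing by the upper ends of the jumps
  gives it the index type that \<open>brick_chains\<close> prescribes.\<close>

definition label_chain :: "('a, 'k list) module set set \<Rightarrow>
    (('a, 'k list) module set, ('a, 'k list) module set) chain" where
  "label_chain C = ({(V, W). V \<in> jump_tops C \<and> W \<in> jump_tops C \<and> V \<subseteq> W}, label C)"

lemma Field_label_order:
  "Field {(V, W). V \<in> jump_tops C \<and> W \<in> jump_tops C \<and> V \<subseteq> W} = jump_tops C"
  by (auto simp: Field_def)

lemma jump_tops_subset: "jump_tops C \<subseteq> C"
  by (auto simp: jump_tops_def jump_def)

lemma jump_topsD:
  assumes "V \<in> jump_tops C"
  obtains U where "jump C U V"
  using assms by (auto simp: jump_tops_def)

lemma label_in_brick_classes: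
  assumes C: "subset.maxchain (tors K A) C" and V: "V \<in> jump_tops C"
  shows "label C V \<in> brick_classes K A"
proof -
  obtain U where j: "jump C U V" by (rule jump_topsD[OF V])
  obtain B where B: "B \<in> label C V" using label_nonempty[OF C j] by blast
  have "label C V = iso_class K A B" by (rule label_iso_class[OF C j B])
  thus ?thesis using label_brick[OF B] by (auto simp: brick_classes_def)
qed

lemma Linear_order_label:
  assumes C: "subset.maxchain (tors K A) C"
  shows "Linear_order {(V, W). V \<in> jump_tops C \<and> W \<in> jump_tops C \<and> V \<subseteq> W}"
  unfolding Field_label_order
  using maxchain_total[OF C] jump_tops_subset[of C]
  by (auto simp: linear_order_on_def partial_order_on_def preorder_on_def refl_on_def trans_def
      antisym_def total_on_def)

text \<open>For \<open>V\<close> strictly below \<open>W\<close>, the bricks in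
  \<open>label C V\<close> are objects of \<open>V\<close>, a member of \<open>C\<close> on which
  maps to \<open>label C W\<close> vanish by definition.\<close>

lemma label_chain_brick_chain:
  assumes C: "subset.maxchain (tors K A) C"
  shows "label_chain C \<in> brick_chains K A"
proof -
  have "hom_zero A M N" if "V \<in> jump_tops C" "W \<in> jump_tops C" "V \<subseteq> W" "V \<noteq> W"
    "M \<in> label C V" "N \<in> label C W" for V W M N
  proof -
    have "V \<in> C" "V \<subset> W" "M \<in> V" using that jump_tops_subset[of C] by (auto simp: label_def)
    thus ?thesis using that(6) by (simp add: label_def)
  qed
  thus ?thesis
    using Linear_order_label[OF C] label_in_brick_classes[OF C]
    unfolding brick_chains_def brick_chain_def label_chain_def mem_Collect_eq prod.case Field_label_order
    by blast
qed

lemma brick_classes_mem: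
  assumes "X \<in> brick_classes K A"
  obtains B where "B \<in> X" "brick K A B" "X = iso_class K A B"
proof -
  obtain B where B: "brick K A B" "X = iso_class K A B" using assms by (auto simp: brick_classes_def)
  have "B \<in> X" using B brick_mod_cat module_iso_refl by (simp add: iso_class_def)
  thus ?thesis using that B by blast
qed

lemma brick_chain_Union_subset:
  assumes "brick_chain K A (r, S)" "J \<subseteq> Field r"
  shows "(\<Union>i\<in>J. S i) \<subseteq> mod_cat K A"
proof
  fix M assume "M \<in> (\<Union>i\<in>J. S i)"
  then obtain i where i: "i \<in> J" "M \<in> S i" by blast
  hence "S i \<in> brick_classes K A" using assms by (auto simp: brick_chain_def)
  thus "M \<in> mod_cat K A" using i(2) by (auto simp: brick_classes_def iso_class_def)
qed

lemma Phi_chain: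
  assumes c: "brick_chain K A (r, S)"
  shows "subset.chain (tors K A) (Phi K A (r, S))"
  unfolding subset_chain_def
proof (intro conjI ballI subsetI)
  have J: "(\<Union>i\<in>J. S i) \<subseteq> mod_cat K A" if "order_ideal r J" for J
    using brick_chain_Union_subset[OF c] that by (simp add: order_ideal_def)
  show "T \<in> tors K A" if "T \<in> Phi K A (r, S)" for T
    using that torsion_closure_least(1)[OF J] by (auto simp: Phi_def)
  fix X Y assume "X \<in> Phi K A (r, S)" "Y \<in> Phi K A (r, S)"
  then obtain I J where IJ: "order_ideal r I" "X = torsion_closure K A (\<Union>i\<in>I. S i)"
      "order_ideal r J" "Y = torsion_closure K A (\<Union>i\<in>J. S i)"
    by (auto simp: Phi_def)
  have "I \<subseteq> J \<or> J \<subseteq> I"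
    using order_ideal_total[OF _ IJ(1,3)] c by (simp add: brick_chain_def)
  thus "X \<subseteq> Y \<or> Y \<subseteq> X"
    unfolding IJ torsion_closure_def by (meson UN_mono hull_mono order_refl)
qed

text \<open>Each \<open>T\<close> in \<open>C\<close> is generated by the labels of the jumps up to
  \<open>T\<close>. If not, \<open>brick_between\<close> gives a brick \<open>S\<close> in
  \<open>T\<close> that receives no nonzero map from what these labels generate. But the jump where
  \<open>Hom(-, S)\<close> stops vanishing has its upper end inside \<open>T\<close>, and its label
  maps nontrivially to \<open>S\<close>.\<close>

lemma Phi_label_chain:
  assumes C: "subset.maxchain (tors K A) C"
  shows "Phi K A (label_chain C) = C"
proof -
  let ?r = "{(V, W). V \<in> jump_tops C \<and> W \<in> jump_tops C \<and> V \<subseteq> W}"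
  have bc: "brick_chain K A (?r, label C)"
    using label_chain_brick_chain[OF C] by (simp add: brick_chains_def label_chain_def)
  have "C \<subseteq> Phi K A (label_chain C)"
  proof
    fix T assume T: "T \<in> C"
    let ?J = "{V \<in> jump_tops C. V \<subseteq> T}"
    let ?T = "torsion_closure K A (\<Union>V\<in>?J. label C V)"
    have J: "order_ideal ?r ?J"
      unfolding order_ideal_def Field_label_order by auto
    have sub: "(\<Union>V\<in>?J. label C V) \<subseteq> mod_cat K A"
      using brick_chain_Union_subset[OF bc, of ?J] by (auto simp: Field_label_order)
    note cl = torsion_closure_least[OF sub]
    have Tt: "torsion_class K A T" by (rule maxchain_torsion_class[OF C T])
    have Tt': "torsion_class K A ?T" using cl(1) by (simp add: tors_def)
    have "(\<Union>V\<in>?J. label C V) \<subseteq> T" by (auto simp: label_def)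
    hence "?T \<subseteq> T" using cl(3) Tt by (simp add: tors_def)
    moreover have "T \<subseteq> ?T"
    proof (rule ccontr)
      assume "\<not> T \<subseteq> ?T"
      from brick_between[OF Tt' Tt this] obtain S where S: "brick K A S" "S \<in> T"
          "\<And>L. L \<in> ?T \<Longrightarrow> hom_zero A L S" by blast
      have SA: "S \<in> mod_cat K A" by (rule brick_mod_cat[OF S(1)])
      obtain U V L where j: "jump C U V" and U: "\<And>L. L \<in> U \<Longrightarrow> hom_zero A L S"
          and L: "L \<in> V" "\<not> hom_zero A L S"
        using enter_hom_jump[OF C SA brick_nonzero[OF S(1)]] by blast
      have "T \<subseteq> U \<or> V \<subseteq> T" using j T by (simp add: jump_def)
      hence "V \<subseteq> T" using U S(2) brick_not_hom_zero[OF S(1)] by blast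
      hence VJ: "V \<in> ?J" using j by (auto simp: jump_tops_def)
      obtain B where B: "B \<in> label C V" using label_nonempty[OF C j] by blast
      have "B \<in> ?T" using cl(2) VJ B by blast
      moreover have "\<not> hom_zero A B S"
        by (rule jump_hom_nonzero[OF C j _ label_not_below[OF j B] SA U L])
          (use B in \<open>simp_all add: label_def\<close>)
      ultimately show False using S(3) by blast
    qed
    ultimately have "T = ?T" by simp
    thus "T \<in> Phi K A (label_chain C)"
      unfolding Phi_def label_chain_def prod.case mem_Collect_eq using J by (intro exI[of _ ?J] conjI)
  qed
  \<comment> \<open>The other inclusion comes from the maximality of \<open>C\<close>, which is
    contained in this chain.\<close>
  moreover have "subset.chain (tors K A) (Phi K A (label_chain C))"
    using Phi_chain[OF bc] by (simp add: label_chain_def)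
  ultimately show ?thesis using C unfolding subset.maxchain_def by blast
qed

lemma brick_chain_hom_zeroD:
  "brick_chain K A (r, S) \<Longrightarrow> (i, j) \<in> r \<Longrightarrow> i \<noteq> j \<Longrightarrow> M \<in> S i \<Longrightarrow> N \<in> S j \<Longrightarrow> hom_zero A M N"
  by (simp add: brick_chain_def)

text \<open>The index \<open>i\<close> is sent to the jump of \<open>C\<close> where maps to
  \<open>S i\<close> cease to vanish, and its label turns out to be \<open>S i\<close>. The
  inclusion of \<open>Phi K A (r, S)\<close> in \<open>C\<close> makes the classes generated by
  ideals comparable with the ends of that jump.\<close>

lemma chain_le_label_chain:
  assumes C: "subset.maxchain (tors K A) C" and c: "brick_chain K A (r, S)"
    and sub: "Phi K A (r, S) \<subseteq> C"
  shows "chain_le (r, S) (label_chain C)"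
proof -
  have r: "Linear_order r" using c by (simp add: brick_chain_def)
  have refl: "(i, i) \<in> r" if "i \<in> Field r" for i
    using r that unfolding linear_order_on_def partial_order_on_def preorder_on_def refl_on_def by blast
  have trans: "(i, k) \<in> r" if "(i, j) \<in> r" "(j, k) \<in> r" for i j k
    using r that unfolding linear_order_on_def partial_order_on_def preorder_on_def trans_def by blast
  have antisym: "i = j" if "(i, j) \<in> r" "(j, i) \<in> r" for i j
    using r that unfolding linear_order_on_def partial_order_on_def antisym_def by blast
  let ?T = "\<lambda>J. torsion_closure K A (\<Union>l\<in>J. S l)"
  \<comment> \<open>The ideals of the indices strictly before \<open>i\<close> and up to
    \<open>i\<close>; the second adds only the generator \<open>S i\<close>.\<close>
  let ?lt = "\<lambda>i. {l. (l, i) \<in> r \<and> l \<noteq> i}" and ?le = "\<lambda>i. {l. (l, i) \<in> r}"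
  have lt: "order_ideal r (?lt i)" for i
    unfolding order_ideal_def using trans antisym by (auto simp: FieldI1)
  have le: "order_ideal r (?le i)" for i
    unfolding order_ideal_def using trans by (auto simp: FieldI1)
  have TC: "?T J \<in> C" if "order_ideal r J" for J
    using sub that unfolding Phi_def prod.case by blast
  have cl: "(\<Union>l\<in>J. S l) \<subseteq> ?T J" "\<And>X. torsion_class K A X \<Longrightarrow> (\<Union>l\<in>J. S l) \<subseteq> X \<Longrightarrow> ?T J \<subseteq> X"
    if "order_ideal r J" for J
  proof -
    have "(\<Union>l\<in>J. S l) \<subseteq> mod_cat K A"
      using brick_chain_Union_subset[OF c] that by (simp add: order_ideal_def)
    from torsion_closure_least(2,3)[OF this]
    show "(\<Union>l\<in>J. S l) \<subseteq> ?T J" "\<And>X. torsion_class K A X \<Longrightarrow> (\<Union>l\<in>J. S l) \<subseteq> X \<Longrightarrow> ?T J \<subseteq> X"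
      by (simp_all add: tors_def)
  qed
  have lt_zero: "hom_zero A L M" if i: "i \<in> Field r" "M \<in> S i" "M \<in> mod_cat K A"
    and L: "L \<in> ?T (?lt i)" for i L M
  proof -
    have "?T (?lt i) \<subseteq> {X \<in> mod_cat K A. hom_zero A X M}"
    proof (rule cl(2)[OF lt torsion_class_hom_zero[OF i(3)]])
      show "(\<Union>l\<in>?lt i. S l) \<subseteq> {X \<in> mod_cat K A. hom_zero A X M}"
      proof (intro UN_least subsetI CollectI conjI)
        fix l X assume l: "l \<in> ?lt i" and X: "X \<in> S l"
        show "X \<in> mod_cat K A"
          using brick_chain_Union_subset[OF c, of "{l}"] l X by (auto simp: FieldI1)
        show "hom_zero A X M" using brick_chain_hom_zeroD[OF c _ _ X i(2)] l by simp
      qed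
    qed
    thus ?thesis using L by blast
  qed
  \<comment> \<open>The third property bounds the chosen jump by what the bricks up to
    \<open>i\<close> generate; the proof of monotonicity below relies on it.\<close>
  have ex: "\<exists>V. V \<in> jump_tops C \<and> S i = label C V \<and> V \<subseteq> ?T (?le i)" if i: "i \<in> Field r" for i
  proof -
    have "S i \<in> brick_classes K A" using c i by (simp add: brick_chain_def)
    then obtain M where M: "M \<in> S i" "brick K A M" "S i = iso_class K A M"
      by (rule brick_classes_mem)
    have MA: "M \<in> mod_cat K A" by (rule brick_mod_cat[OF M(2)])
    obtain U V L where j: "jump C U V" and U: "\<And>L. L \<in> U \<Longrightarrow> hom_zero A L M"
        and L: "L \<in> V" "\<not> hom_zero A L M"
      using enter_hom_jump[OF C MA brick_nonzero[OF M(2)]] by blast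
    have "M \<in> ?T (?le i)" using cl(1)[OF le] M(1) refl[OF i] by blast
    hence "\<not> ?T (?le i) \<subseteq> U" using U brick_not_hom_zero[OF M(2)] by blast
    hence Vle: "V \<subseteq> ?T (?le i)" using j TC[OF le, of i] unfolding jump_def by blast
    have V: "torsion_class K A V" using maxchain_torsion_class[OF C] j by (simp add: jump_def)
    have LA: "L \<in> mod_cat K A"
      by (rule torsion_mod_cat[OF V L(1)])
    let ?W = "zero_or_onto M"
    have W: "torsion_class K A ?W" by (rule torsion_class_zero_or_onto[OF MA])
    have MW: "M \<in> ?W" by (rule brick_zero_or_onto[OF M(2)])
    \<comment> \<open>Bricks before \<open>i\<close> have no nonzero maps to \<open>M\<close>, and
      those in \<open>S i\<close> are isomorphic to \<open>M\<close>, so all generators lie in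
      \<open>?W\<close>. A nonzero map from \<open>L\<close> to \<open>M\<close> is therefore onto,
      which puts \<open>M\<close> into \<open>V\<close>.\<close>
    have "?T (?le i) \<subseteq> ?W"
    proof (rule cl(2)[OF le W], rule UN_least)
      fix l assume l: "l \<in> ?le i"
      show "S l \<subseteq> ?W"
      proof (cases "l = i")
        case True
        show ?thesis
        proof
          fix N assume "N \<in> S l"
          hence "N \<in> mod_cat K A" "module_iso A M N" using M(3) True by (auto simp: iso_class_def)
          thus "N \<in> ?W" by (rule torsion_iso[OF W MW])
        qed
      next
        case False
        show ?thesis
        proof
          fix N assume N: "N \<in> S l"
          have NT: "N \<in> ?T (?lt i)" using cl(1)[OF lt] N l False by blast
          have NA: "N \<in> mod_cat K A"
            by (rule torsion_mod_cat[OF maxchain_torsion_class[OF C TC[OF lt]] NT])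
          have "hom_zero A N M" by (rule lt_zero[OF i M(1) MA NT])
          thus "N \<in> ?W" by (rule hom_zero_zero_or_onto[OF NA MA])
        qed
      qed
    qed
    hence LW: "L \<in> ?W" using Vle L(1) by blast
    obtain f where f: "f \<in> module_hom A L M" "f ` carrier L \<noteq> {\<zero>\<^bsub>M\<^esub>}"
      using L(2) hom_zero_iff_image[OF LA MA] by blast
    have "f ` carrier L = carrier M" by (rule zero_or_ontoD[OF LW f])
    hence "M \<in> V" by (rule torsion_quotient[OF V L(1) MA f(1)])
    hence "M \<in> label C V" using M(2) U by (simp add: label_iff[OF j])
    hence "S i = label C V" using label_iso_class[OF C j] M(3) by simp
    thus ?thesis using Vle j by (auto simp: jump_tops_def)
  qed
  then obtain f where f: "\<And>i. i \<in> Field r \<Longrightarrow> f i \<in> jump_tops C"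
    "\<And>i. i \<in> Field r \<Longrightarrow> S i = label C (f i)" "\<And>i. i \<in> Field r \<Longrightarrow> f i \<subseteq> ?T (?le i)"
    by metis
  \<comment> \<open>For \<open>i\<close> before \<open>j\<close>, the class \<open>f i\<close> lies
    in the class generated strictly before \<open>j\<close>, which has no nonzero maps to the bricks
    in \<open>S j\<close>. As \<open>f j\<close> contains such a brick, it cannot lie inside
    \<open>f i\<close>.\<close>
  have mono: "f i \<subseteq> f j" if ij: "(i, j) \<in> r" for i j
  proof (cases "i = j")
    case False
    have F: "i \<in> Field r" "j \<in> Field r" using ij by (auto simp: FieldI1 FieldI2)
    have "S j \<in> brick_classes K A" using c F(2) by (simp add: brick_chain_def)
    then obtain M where M: "M \<in> S j" "brick K A M" by (rule brick_classes_mem)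
    have "?T (?le i) \<subseteq> ?T (?lt j)"
      unfolding torsion_closure_def
      by (intro hull_mono UN_mono) (use trans[OF _ ij] antisym[OF ij] False in auto)
    hence "hom_zero A L M" if "L \<in> f i" for L
      using lt_zero[OF F(2) M(1) brick_mod_cat[OF M(2)]] f(3)[OF F(1)] that by blast
    moreover have "M \<in> f j" using M(1) f(2)[OF F(2)] by (simp add: label_def)
    ultimately have "\<not> f j \<subseteq> f i" using brick_not_hom_zero[OF M(2)] by blast
    thus ?thesis using maxchain_total[OF C] f(1)[OF F(1)] f(1)[OF F(2)] jump_tops_subset[of C] by blast
  qed simp
  have inj: "inj_on f (Field r)"
  proof (rule inj_onI)
    fix i j assume "i \<in> Field r" "j \<in> Field r" "f i = f j"
    thus "i = j" using inj_onD[OF brick_chain_inj_on[OF c], of i j] f(2) by simp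
  qed
  show ?thesis
    unfolding chain_le_def label_chain_def prod.case Field_label_order
    by (rule bexI[of _ f]) (use inj mono f(1,2) in \<open>auto simp: FieldI1 FieldI2\<close>)
qed

text \<open>A brick \<open>B\<close> at an index \<open>i\<close> missed by \<open>f\<close> is
  squeezed from both sides. The label of the jump \<open>V\<close> where \<open>Hom(-, B)\<close>
  stops vanishing maps to \<open>B\<close>, so \<open>i\<close> comes before \<open>f V\<close>;
  \<open>B\<close> maps to the label of the jump \<open>V'\<close> where it enters \<open>C\<close>,
  so \<open>i\<close> comes after \<open>f V'\<close>. Hence \<open>V'\<close> lies strictly below
  \<open>V\<close>, that is, inside \<open>U\<close>, and \<open>B\<close> would belong to a class
  on which maps to \<open>B\<close> vanish.\<close>

lemma label_chain_maximal:
  assumes C: "subset.maxchain (tors K A) C" and d: "brick_chain K A (r, S)"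
    and le: "chain_le (label_chain C) (r, S)"
  shows "chain_le (r, S) (label_chain C)"
proof -
  let ?q = "{(V, W). V \<in> jump_tops C \<and> W \<in> jump_tops C \<and> V \<subseteq> W}"
  have r: "Linear_order r" using d by (simp add: brick_chain_def)
  have antisym: "i = j" if "(i, j) \<in> r" "(j, i) \<in> r" for i j
    using r that unfolding linear_order_on_def partial_order_on_def antisym_def by blast
  have trans: "(i, k) \<in> r" if "(i, j) \<in> r" "(j, k) \<in> r" for i j k
    using r that unfolding linear_order_on_def partial_order_on_def preorder_on_def trans_def by blast
  have total: "(i, j) \<in> r \<or> (j, i) \<in> r" if "i \<in> Field r" "j \<in> Field r" "i \<noteq> j" for i j
    using r that unfolding linear_order_on_def total_on_def by blast
  obtain f where f0: "f \<in> jump_tops C \<rightarrow> Field r" and inj: "inj_on f (jump_tops C)"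
      and mono0: "\<forall>V W. (V, W) \<in> ?q \<longrightarrow> (f V, f W) \<in> r"
      and S0: "\<forall>V\<in>jump_tops C. label C V = S (f V)"
    using le unfolding chain_le_def label_chain_def prod.case Field_label_order by blast
  have fF: "f V \<in> Field r" if "V \<in> jump_tops C" for V using f0 that by (rule funcset_mem)
  have mono: "(f V, f W) \<in> r" if "V \<in> jump_tops C" "W \<in> jump_tops C" "V \<subseteq> W" for V W
    using mono0 that by blast
  have "i \<in> f ` jump_tops C" if i: "i \<in> Field r" for i
  proof (rule ccontr)
    assume n: "i \<notin> f ` jump_tops C"
    have "S i \<in> brick_classes K A" using d i by (simp add: brick_chain_def)
    then obtain B where B: "B \<in> S i" "brick K A B" by (rule brick_classes_mem)
    have BA: "B \<in> mod_cat K A" by (rule brick_mod_cat[OF B(2)])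
    obtain U V L where j: "jump C U V" and U: "\<And>L. L \<in> U \<Longrightarrow> hom_zero A L B"
        and L: "L \<in> V" "\<not> hom_zero A L B"
      using enter_hom_jump[OF C BA brick_nonzero[OF B(2)]] by blast
    obtain U' V' where j': "jump C U' V'" and B': "B \<in> V'" "B \<notin> U'"
      using enter_mem_jump[OF C BA brick_nonzero[OF B(2)]] by blast
    have V: "V \<in> jump_tops C" "V' \<in> jump_tops C" using j j' by (auto simp: jump_tops_def)
    obtain E where E: "E \<in> label C V" using label_nonempty[OF C j] by blast
    obtain E' where E': "E' \<in> label C V'" using label_nonempty[OF C j'] by blast
    have "\<not> hom_zero A E B"
      by (rule jump_hom_nonzero[OF C j _ label_not_below[OF j E] BA U L])
        (use E in \<open>simp_all add: label_def\<close>)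
    moreover have "E \<in> S (f V)" using E S0 V(1) by blast
    ultimately have "(f V, i) \<notin> r" using brick_chain_hom_zeroD[OF d _ _ _ B(1)] n V(1) by blast
    hence iV: "(i, f V) \<in> r" using total[OF i fF[OF V(1)]] n V(1) by blast
    have "\<not> hom_zero A B E'"
    proof (rule jump_hom_nonzero[OF C j' B' brick_mod_cat[OF label_brick[OF E']]])
      show "\<not> hom_zero A E' E'" by (rule brick_not_hom_zero[OF label_brick[OF E']])
    qed (use E' in \<open>auto simp: label_iff[OF j']\<close>)
    moreover have "E' \<in> S (f V')" using E' S0 V(2) by blast
    ultimately have "(i, f V') \<notin> r" using brick_chain_hom_zeroD[OF d _ _ B(1)] n V(2) by blast
    hence Vi: "(f V', i) \<in> r" using total[OF i fF[OF V(2)]] n V(2) by blast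
    have "\<not> V \<subseteq> V'"
    proof
      assume "V \<subseteq> V'"
      hence "(f V, f V') \<in> r" by (rule mono[OF V])
      hence "i = f V'" using antisym[OF Vi] trans[OF iV] by blast
      thus False using n V(2) by blast
    qed
    moreover have "V' \<in> C" using j' by (simp add: jump_def)
    ultimately have "V' \<subseteq> U" using j by (auto simp: jump_def)
    thus False using U B'(1) brick_not_hom_zero[OF B(2)] by blast
  qed
  hence surj: "f ` Field ?q = Field r" using fF unfolding Field_label_order by blast
  show ?thesis unfolding label_chain_def
  proof (rule chain_le_surj_sym[OF Linear_order_label[OF C] r surj])
    show "inj_on f (Field ?q)" using inj unfolding Field_label_order .
    show "(f V, f W) \<in> r" if "(V, W) \<in> ?q" for V W using mono0 that by blast
    show "label C V = S (f V)" if "V \<in> Field ?q" for V using S0 that unfolding Field_label_order by blast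
  qed
qed

section \<open>The bijection on maximal chains\<close>

lemma Phi_equiv:
  assumes "(c, d) \<in> brick_chain_equiv K A"
  shows "Phi K A c = Phi K A d"
proof -
  obtain r S r' S' where eq: "c = (r, S)" "d = (r', S')" by (metis surj_pair)
  have "brick_chain K A (r, S)" "brick_chain K A (r', S')"
    and le: "chain_le (r, S) (r', S')" "chain_le (r', S') (r, S)"
    using assms by (auto simp: eq brick_chain_equiv_def brick_chains_def)
  hence inj: "inj_on S (Field r)" "inj_on S' (Field r')" by (auto intro: brick_chain_inj_on)
  show ?thesis unfolding eq
    by (rule equalityI chain_le_Phi_subset[OF inj le] chain_le_Phi_subset[OF inj(2,1) le(2,1)])+
qed

lemma label_chain_max:
  assumes C: "subset.maxchain (tors K A) C"
  shows "label_chain C \<in> max_brick_chains K A"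
  unfolding max_brick_chains_def mem_Collect_eq
proof (intro conjI ballI impI)
  show bc: "label_chain C \<in> brick_chains K A" by (rule label_chain_brick_chain[OF C])
  fix d assume d: "d \<in> brick_chains K A" and le: "chain_le (label_chain C) d"
  obtain r S where eq: "d = (r, S)" by (metis surj_pair)
  have "chain_le d (label_chain C)"
    using label_chain_maximal[OF C] d le by (simp add: eq brick_chains_def)
  thus "(label_chain C, d) \<in> brick_chain_equiv K A" using bc d le by (simp add: brick_chain_equiv_def)
qed

text \<open>The Hausdorff principle is applied to the torsion classes comparable with all of
  \<open>D\<close>. A maximal chain there absorbs \<open>D\<close>, and every chain of torsion
  classes containing \<open>D\<close> stays in this subposet, so maximality carries over to
  \<open>tors K A\<close>.\<close>

lemma tors_chain_extend:
  assumes D: "subset.chain (tors K A) D"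
  shows "\<exists>C. subset.maxchain (tors K A) C \<and> D \<subseteq> C"
proof -
  define B where "B = {T \<in> tors K A. \<forall>X\<in>D. T \<subseteq> X \<or> X \<subseteq> T}"
  obtain C where C: "subset.maxchain B C" using subset.Hausdorff[of B] by blast
  have CB: "C \<subseteq> B" and tot: "\<forall>X\<in>C. \<forall>Y\<in>C. X \<subseteq> Y \<or> Y \<subseteq> X"
    using subset.maxchain_imp_chain[OF C] by (simp_all add: subset_chain_def)
  have Dt: "D \<subseteq> tors K A" and Dtot: "\<forall>X\<in>D. \<forall>Y\<in>D. X \<subseteq> Y \<or> Y \<subseteq> X"
    using D by (simp_all add: subset_chain_def)
  have DB: "D \<subseteq> B" using Dt Dtot unfolding B_def by blast
  have cmp: "X \<subseteq> Y \<or> Y \<subseteq> X" if "X \<in> C" "Y \<in> D" for X Y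
    using that CB unfolding B_def by blast
  have max: "\<not> C \<subset> C'" if "subset.chain B C'" for C'
    using C that by (simp add: subset.maxchain_def)
  have "subset.chain B (C \<union> D)"
    unfolding subset_chain_def
  proof (intro conjI ballI)
    show "C \<union> D \<subseteq> B" using CB DB by (rule Un_least)
    show "X \<subseteq> Y \<or> Y \<subseteq> X" if "X \<in> C \<union> D" "Y \<in> C \<union> D" for X Y
      using that tot Dtot cmp[of X Y] cmp[of Y X] by (elim UnE) blast+
  qed
  hence "\<not> C \<subset> C \<union> D" by (rule max)
  hence DC: "D \<subseteq> C" by blast
  have "subset.maxchain (tors K A) C"
    unfolding subset.maxchain_def
  proof (intro conjI notI)
    have "C \<subseteq> tors K A" using CB by (auto simp: B_def)
    thus "subset.chain (tors K A) C" using tot by (simp add: subset_chain_def)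
    assume "\<exists>S. subset.chain (tors K A) S \<and> C \<subset> S"
    then obtain C' where C': "subset.chain (tors K A) C'" "C \<subset> C'" by blast
    hence C't: "C' \<subseteq> tors K A" and C'tot: "\<forall>X\<in>C'. \<forall>Y\<in>C'. X \<subseteq> Y \<or> Y \<subseteq> X"
      by (simp_all add: subset_chain_def)
    have "D \<subseteq> C'" using DC C'(2) by blast
    hence "C' \<subseteq> B" using C't C'tot unfolding B_def by blast
    hence "subset.chain B C'" using C'tot by (simp add: subset_chain_def)
    thus False using max C'(2) by blast
  qed
  thus ?thesis using DC by blast
qed

text \<open>Extend \<open>Phi K A c\<close> to a maximal chain \<open>C\<close>. Then
  \<open>c\<close> embeds into \<open>label_chain C\<close>, and the maximality of \<open>c\<close>
  makes the two equivalent, so \<open>Phi K A c\<close> is \<open>C\<close> itself by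
  \<open>Phi_label_chain\<close>.\<close>

lemma max_brick_chain_Phi:
  assumes c: "c \<in> max_brick_chains K A"
  shows "subset.maxchain (tors K A) (Phi K A c)"
    and "(c, label_chain (Phi K A c)) \<in> brick_chain_equiv K A"
proof -
  obtain r S where eq: "c = (r, S)" by (metis surj_pair)
  have bc: "brick_chain K A (r, S)" and
    max: "\<And>d. d \<in> brick_chains K A \<Longrightarrow> chain_le c d \<Longrightarrow> (c, d) \<in> brick_chain_equiv K A"
    using c by (auto simp: max_brick_chains_def brick_chains_def eq)
  obtain C where C: "subset.maxchain (tors K A) C" "Phi K A c \<subseteq> C"
    using tors_chain_extend[OF Phi_chain[OF bc]] unfolding eq by blast
  have "chain_le c (label_chain C)"
    using chain_le_label_chain[OF C(1) bc] C(2) by (simp add: eq)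
  hence *: "(c, label_chain C) \<in> brick_chain_equiv K A"
    by (rule max[OF label_chain_brick_chain[OF C(1)]])
  have "Phi K A c = C" using Phi_equiv[OF *] Phi_label_chain[OF C(1)] by simp
  thus "subset.maxchain (tors K A) (Phi K A c)"
    "(c, label_chain (Phi K A c)) \<in> brick_chain_equiv K A"
    using C(1) * by simp_all
qed

end

theorem theoremA3:
  fixes K :: "('k, 'r) ring_scheme" and A :: "('k, 'a, 's) module_scheme"
  assumes "fin_dim_algebra K A"
  shows "(\<forall>c \<in> max_brick_chains K A. \<forall>d. (c, d) \<in> brick_chain_equiv K A \<longrightarrow> Phi K A c = Phi K A d) \<and>
    bij_betw (\<lambda>X. the_elem (Phi K A ` X))
      (max_brick_chains K A // brick_chain_equiv K A)
      {C. subset.maxchain (tors K A) C}"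
proof -
  interpret fin_dim_algebra K A by (rule assms)
  let ?R = "brick_chain_equiv K A"
  have equiv: "equiv (brick_chains K A) ?R" by (rule equiv_brick_chain_equiv)
  have bc: "c \<in> brick_chains K A" if "c \<in> max_brick_chains K A" for c
    using that by (simp add: max_brick_chains_def)
  \<comment> \<open>\<open>Phi\<close> is constant on an equivalence class, so the image is a
    singleton and \<open>the_elem\<close> returns the common value.\<close>
  have val: "the_elem (Phi K A ` (?R `` {c})) = Phi K A c" if c: "c \<in> max_brick_chains K A" for c
  proof -
    have "c \<in> ?R `` {c}" by (rule equiv_class_self[OF equiv bc[OF c]])
    moreover have "Phi K A d = Phi K A c" if "d \<in> ?R `` {c}" for d
      using Phi_equiv[of c d] that by simp
    ultimately have "Phi K A ` (?R `` {c}) = {Phi K A c}" by blast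
    thus ?thesis by simp
  qed
  have "bij_betw (\<lambda>X. the_elem (Phi K A ` X)) (max_brick_chains K A // ?R)
      {C. subset.maxchain (tors K A) C}"
    unfolding bij_betw_def
  proof (rule conjI, rule inj_onI)
    fix X Y assume "X \<in> max_brick_chains K A // ?R" "Y \<in> max_brick_chains K A // ?R"
      and eq: "the_elem (Phi K A ` X) = the_elem (Phi K A ` Y)"
    then obtain c d where cd: "c \<in> max_brick_chains K A" "X = ?R `` {c}"
        "d \<in> max_brick_chains K A" "Y = ?R `` {d}"
      by (auto elim!: quotientE)
    have "Phi K A c = Phi K A d" using eq val cd by simp
    \<comment> \<open>Both \<open>c\<close> and \<open>d\<close> are equivalent to the label chain
      of their common image.\<close>
    hence "(d, label_chain (Phi K A c)) \<in> ?R" using max_brick_chain_Phi(2)[OF cd(3)] by simp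
    hence "(c, d) \<in> ?R"
      using max_brick_chain_Phi(2)[OF cd(1)] equiv by (meson equivE symE transE)
    thus "X = Y" using cd equiv_class_eq[OF equiv] by simp
  next
    show "(\<lambda>X. the_elem (Phi K A ` X)) ` (max_brick_chains K A // ?R) =
        {C. subset.maxchain (tors K A) C}"
    proof (intro equalityI subsetI)
      fix C assume "C \<in> (\<lambda>X. the_elem (Phi K A ` X)) ` (max_brick_chains K A // ?R)"
      then obtain c where "c \<in> max_brick_chains K A" "C = the_elem (Phi K A ` (?R `` {c}))"
        by (auto elim!: quotientE)
      thus "C \<in> {C. subset.maxchain (tors K A) C}" using val max_brick_chain_Phi(1) by simp
    next
      fix C assume "C \<in> {C. subset.maxchain (tors K A) C}"
      hence C: "subset.maxchain (tors K A) C" by simp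
      have m: "label_chain C \<in> max_brick_chains K A" by (rule label_chain_max[OF C])
      have "C = the_elem (Phi K A ` (?R `` {label_chain C}))"
        using val[OF m] Phi_label_chain[OF C] by simp
      thus "C \<in> (\<lambda>X. the_elem (Phi K A ` X)) ` (max_brick_chains K A // ?R)"
        using quotientI[OF m] by blast
    qed
  qed
  thus ?thesis using Phi_equiv by blast
qed

end
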